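(* Let $r_1,r_2>0$ be real numbers and let $g_r=g_{(r_1,r_2)}$ be the left invariant Riemannian metric on $Sp(2)$ determined by $$\Big|Q\begin{pmatrix} x& y\\ -\overline{y}& z\end{pmatrix}\Big|^2_{g_r}=\frac{r_1}{2}|x|^2+|y|^2+\frac{r_2}{2}|z|^2$$ for all $Q\in Sp(2)$ and all $x,y,z\in\mathbb{H}$ with $\mathrm{Re}(x)=\mathrm{Re}(z)=0$. Then: (1) The sectional curvature of $g_r$ is nonnegative if and only if $r_1+r_2\le 2$. (2) The metric $g_r$ is Einstein if and only if $r_1=r_2=1$ or $r_1=r_2=\frac12$.
   Context: $\mathbb{H}$ denotes the quaternions, identified with $\mathbb{R}^4$ with its Euclidean norm $|\cdot|$; $\overline{y}$ is the quaternionic conjugate and $\mathrm{Re}$ the real part. $Sp(2)=\{Q\in M(2,\mathbb{H}) : QQ^*=I\}$, where $Q^*$ is the conjugate transpose. Its tangent space at $Q$ is $$T_QSp(2)=\Big\{Q\begin{pmatrix} x& y\\ -\overline{y}& z\end{pmatrix} : x,y,z\in\mathbb{H},\ \mathrm{Re}(x)=\mathrm{Re}(z)=0\Big\}.$$ *)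

theory Defs
  imports "HOL-Analysis.Analysis"
begin

section \<open>Quaternions\<close>

codatatype quat = Quat (qRe: real) (qI: real) (qJ: real) (qK: real)

lemma quat_eq_iff: "x = y \<longleftrightarrow> qRe x = qRe y \<and> qI x = qI y \<and> qJ x = qJ y \<and> qK x = qK y"
  by (auto intro: quat.expand)

instantiation quat :: ab_group_add
begin

primcorec zero_quat where
  "qRe 0 = 0" | "qI 0 = 0" | "qJ 0 = 0" | "qK 0 = 0"

primcorec plus_quat where
  "qRe (x + y) = qRe x + qRe y"
| "qI (x + y) = qI x + qI y"
| "qJ (x + y) = qJ x + qJ y"
| "qK (x + y) = qK x + qK y"

primcorec uminus_quat where
  "qRe (- x) = - qRe x"
| "qI (- x) = - qI x"
| "qJ (- x) = - qJ x"
| "qK (- x) = - qK x"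

primcorec minus_quat where
  "qRe (x - y) = qRe x - qRe y"
| "qI (x - y) = qI x - qI y"
| "qJ (x - y) = qJ x - qJ y"
| "qK (x - y) = qK x - qK y"

instance
  by standard (simp_all add: quat_eq_iff)

end

instantiation quat :: ring_1
begin

primcorec one_quat where
  "qRe 1 = 1" | "qI 1 = 0" | "qJ 1 = 0" | "qK 1 = 0"

primcorec times_quat where
  "qRe (x * y) = qRe x * qRe y - qI x * qI y - qJ x * qJ y - qK x * qK y"
| "qI (x * y) = qRe x * qI y + qI x * qRe y + qJ x * qK y - qK x * qJ y"
| "qJ (x * y) = qRe x * qJ y - qI x * qK y + qJ x * qRe y + qK x * qI y"
| "qK (x * y) = qRe x * qK y + qI x * qJ y - qJ x * qI y + qK x * qRe y"

instance
  by standard (simp_all add: quat_eq_iff algebra_simps)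

end

instantiation quat :: real_algebra_1
begin

primcorec scaleR_quat where
  "qRe (scaleR r x) = r * qRe x"
| "qI (scaleR r x) = r * qI x"
| "qJ (scaleR r x) = r * qJ x"
| "qK (scaleR r x) = r * qK x"

instance
  by standard (simp_all add: quat_eq_iff algebra_simps)

end

primcorec qcnj :: "quat \<Rightarrow> quat" where
  "qRe (qcnj x) = qRe x"
| "qI (qcnj x) = - qI x"
| "qJ (qcnj x) = - qJ x"
| "qK (qcnj x) = - qK x"

instantiation quat :: real_inner
begin

definition inner_quat_def:
  "inner x y = qRe x * qRe y + qI x * qI y + qJ x * qJ y + qK x * qK y"

definition norm_quat_def:
  "norm x = sqrt ((qRe x)\<^sup>2 + (qI x)\<^sup>2 + (qJ x)\<^sup>2 + (qK x)\<^sup>2)"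

definition sgn_quat_def: "sgn x = x /\<^sub>R norm x" for x :: quat

definition dist_quat_def: "dist x y = norm (x - y)" for x y :: quat

definition uniformity_quat_def [code del]:
  "(uniformity :: (quat \<times> quat) filter) = (INF e\<in>{0 <..}. principal {(x, y). dist x y < e})"

definition open_quat_def [code del]:
  "open (U :: quat set) \<longleftrightarrow> (\<forall>x\<in>U. eventually (\<lambda>(x', y). x' = x \<longrightarrow> y \<in> U) uniformity)"

instance
proof
  fix x y z :: quat and r :: real
  show "inner x y = inner y x"
    by (simp add: inner_quat_def mult.commute)
  show "inner (x + y) z = inner x z + inner y z"
    by (simp add: inner_quat_def algebra_simps)
  show "inner (scaleR r x) y = r * inner x y"
    by (simp add: inner_quat_def algebra_simps)
  show "0 \<le> inner x x"
    by (simp add: inner_quat_def)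
  show "inner x x = 0 \<longleftrightarrow> x = 0"
    by (auto simp: inner_quat_def add_nonneg_eq_0_iff quat_eq_iff)
  show "norm x = sqrt (inner x x)"
    by (simp add: inner_quat_def norm_quat_def power2_eq_square)
qed (rule sgn_quat_def dist_quat_def open_quat_def uniformity_quat_def)+

end

lemma norm_mult_quat: "norm (x * y) = norm x * norm y" for x y :: quat
  by (simp add: norm_quat_def real_sqrt_mult [symmetric] power2_eq_square algebra_simps)

instance quat :: real_normed_algebra_1
proof
  show "norm (x * y) \<le> norm x * norm y" for x y :: quat
    by (simp only: norm_mult_quat order_refl)
  show "norm (1 :: quat) = 1"
    by (simp add: norm_quat_def)
qed

instantiation quat :: euclidean_space
begin

definition Basis_quat_def: "Basis = {1, Quat 0 1 0 0, Quat 0 0 1 0, Quat 0 0 0 1}"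

instance
proof
  show "(Basis :: quat set) \<noteq> {}" "finite (Basis :: quat set)"
    by (simp_all add: Basis_quat_def)
  show "inner u v = (if u = v then 1 else 0)" if "u \<in> Basis" "v \<in> Basis" for u v :: quat
    using that unfolding Basis_quat_def
    by (elim insertE emptyE; simp add: inner_quat_def quat_eq_iff)
  show "(\<forall>u\<in>Basis. inner x u = 0) \<longleftrightarrow> x = 0" for x :: quat
    by (simp add: Basis_quat_def inner_quat_def quat_eq_iff[of x])
qed

end

instantiation quat :: real_normed_div_algebra
begin

definition inverse_quat_def: "inverse x = qcnj x /\<^sub>R (norm x)\<^sup>2" for x :: quat

definition divide_quat_def: "x div y = x * inverse y" for x y :: quat

lemma quat_norm_sq: "(norm x)\<^sup>2 = (qRe x)\<^sup>2 + (qI x)\<^sup>2 + (qJ x)\<^sup>2 + (qK x)\<^sup>2" for x :: quat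
  by (simp add: norm_quat_def)

lemma mult_qcnj: "x * qcnj x = (norm x)\<^sup>2 *\<^sub>R 1" "qcnj x * x = (norm x)\<^sup>2 *\<^sub>R 1"
  by (simp_all add: quat_eq_iff quat_norm_sq) (simp_all add: power2_eq_square)

instance
proof
  fix x y :: quat
  show "x \<noteq> 0 \<Longrightarrow> inverse x * x = 1"
    by (simp add: inverse_quat_def mult_qcnj)
  show "x \<noteq> 0 \<Longrightarrow> x * inverse x = 1"
    by (simp add: inverse_quat_def mult_qcnj)
  show "x div y = x * inverse y"
    by (simp add: divide_quat_def)
  show "inverse 0 = (0 :: quat)"
    by (simp add: inverse_quat_def)
  show "norm (x * y) = norm x * norm y"
    by (rule norm_mult_quat)
qed

end


section \<open>The group Sp(2)\<close>

type_synonym qmat = "quat^2^2"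

definition qadj :: "qmat \<Rightarrow> qmat" where
  "qadj Q = (\<chi> i j. qcnj (Q $ j $ i))"

definition Sp2 :: "qmat set" where
  "Sp2 = {Q. Q ** qadj Q = mat 1}"

definition sp2_mat :: "quat \<Rightarrow> quat \<Rightarrow> quat \<Rightarrow> qmat" where
  "sp2_mat x y z = vector [vector [x, y], vector [- qcnj y, z]]"

definition T_Sp2 :: "qmat \<Rightarrow> qmat set" where
  "T_Sp2 Q = {Q ** sp2_mat x y z | x y z. qRe x = 0 \<and> qRe z = 0}"

text \<open>A Riemannian metric is a function taking a base point and two tangent vectors.
  The metric \<open>g_r\<close> is given by polarising its quadratic form; on \<open>Sp2\<close> the matrix
  \<open>qadj Q ** U\<close> is the \<open>sp2_mat x y z\<close> with \<open>U = Q ** sp2_mat x y z\<close>.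
  It is left invariant and has the prescribed quadratic form by the lemmas below.\<close>

type_synonym metric = "qmat \<Rightarrow> qmat \<Rightarrow> qmat \<Rightarrow> real"

definition g_r :: "real \<Rightarrow> real \<Rightarrow> metric" where
  "g_r r1 r2 Q U V =
    (let A = qadj Q ** U; B = qadj Q ** V in
      r1 / 2 * ((A $ 1 $ 1) \<bullet> (B $ 1 $ 1)) + (A $ 1 $ 2) \<bullet> (B $ 1 $ 2)
      + r2 / 2 * ((A $ 2 $ 2) \<bullet> (B $ 2 $ 2)))"

lemma qcnj_mult: "qcnj (x * y) = qcnj y * qcnj x"
  by (simp add: quat_eq_iff algebra_simps)

lemma qcnj_add: "qcnj (x + y) = qcnj x + qcnj y"
  by (simp add: quat_eq_iff)

lemma qadj_mult: "qadj (P ** Q) = qadj Q ** qadj P"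
  by (simp add: vec_eq_iff qadj_def matrix_matrix_mult_def sum_2 qcnj_mult qcnj_add)

lemma quat_mat_left_inverse:
  fixes A B :: qmat
  assumes "A ** B = mat 1"
  shows "B ** A = mat 1"
proof -
  have lin: "linear (\<lambda>X. X ** M)" for M :: qmat
    by (rule linearI)
       (simp_all add: vec_eq_iff matrix_matrix_mult_def sum.distrib distrib_right scaleR_sum_right)
  have "inj (\<lambda>X. X ** A)"
    by (rule inj_on_inverseI[where g = "\<lambda>X. X ** B"])
       (simp add: matrix_mul_assoc[symmetric] assms)
  then have "surj (\<lambda>X. X ** A)"
    using lin linear_injective_imp_surjective by blast
  then obtain X where X: "X ** A = mat 1"
    by (metis surjD)
  have "X = X ** (A ** B)"
    by (simp only: assms matrix_mul_rid)
  also have "\<dots> = B"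
    by (simp only: matrix_mul_assoc X matrix_mul_lid)
  finally have "X = B" .
  with X show ?thesis by simp
qed

lemma Sp2_adj_left: "Q \<in> Sp2 \<Longrightarrow> qadj Q ** Q = mat 1"
  by (simp add: Sp2_def quat_mat_left_inverse)

lemma g_r_norm:
  assumes "Q \<in> Sp2"
  shows "g_r r1 r2 Q (Q ** sp2_mat x y z) (Q ** sp2_mat x y z)
    = r1 / 2 * (norm x)\<^sup>2 + (norm y)\<^sup>2 + r2 / 2 * (norm z)\<^sup>2"
proof -
  have "qadj Q ** (Q ** S) = S" for S :: qmat
    by (simp only: matrix_mul_assoc Sp2_adj_left[OF assms] matrix_mul_lid)
  then show ?thesis
    by (simp only: g_r_def Let_def sp2_mat_def vector_2 power2_norm_eq_inner)
qed

lemma g_r_left_invariant: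
  assumes "P \<in> Sp2"
  shows "g_r r1 r2 (P ** Q) (P ** U) (P ** V) = g_r r1 r2 Q U V"
proof -
  have "qadj (P ** Q) ** (P ** W) = qadj Q ** W" for W :: qmat
  proof -
    have "qadj (P ** Q) ** (P ** W) = qadj Q ** ((qadj P ** P) ** W)"
      by (simp only: qadj_mult matrix_mul_assoc)
    then show ?thesis
      by (simp only: Sp2_adj_left[OF assms] matrix_mul_lid)
  qed
  then show ?thesis
    by (simp only: g_r_def)
qed

lemma g_r_bilinear: "bilinear (g_r r1 r2 Q)"
proof -
  have "A ** (c *\<^sub>R U) = c *\<^sub>R (A ** U)" for A U :: qmat and c
    by (simp add: vec_eq_iff matrix_matrix_mult_def scaleR_sum_right)
  then show ?thesis
    unfolding bilinear_def
    by (auto intro!: linearI simp: g_r_def Let_def matrix_add_ldistrib inner_add_left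
        inner_add_right distrib_left add_divide_distrib algebra_simps)
qed

lemma g_r_commute: "g_r r1 r2 Q U V = g_r r1 r2 Q V U"
  by (simp add: g_r_def Let_def inner_commute)


section \<open>Calculus on Sp(2) as a submanifold of the quaternionic matrices\<close>

primrec times_differentiable_on :: "nat \<Rightarrow> ('a::real_normed_vector) set \<Rightarrow> ('a \<Rightarrow> 'b::real_normed_vector) \<Rightarrow> bool"
where
  "times_differentiable_on 0 S f \<longleftrightarrow> continuous_on S f"
| "times_differentiable_on (Suc k) S f \<longleftrightarrow>
     (\<forall>x\<in>S. f differentiable (at x)) \<and>
     (\<forall>v. times_differentiable_on k S (\<lambda>x. frechet_derivative f (at x) v))"

definition smooth_on_open :: "('a::real_normed_vector) set \<Rightarrow> ('a \<Rightarrow> 'b::real_normed_vector) \<Rightarrow> bool" where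
  "smooth_on_open S f \<longleftrightarrow> open S \<and> (\<forall>k. times_differentiable_on k S f)"

text \<open>A function on \<open>Sp2\<close> is smooth if near each point it extends to a smooth function on
  an open subset of the ambient space. Values off \<open>Sp2\<close> are irrelevant.\<close>

definition smooth_Sp2 :: "(qmat \<Rightarrow> 'b::real_normed_vector) \<Rightarrow> bool" where
  "smooth_Sp2 f \<longleftrightarrow>
    (\<forall>Q\<in>Sp2. \<exists>U F. Q \<in> U \<and> smooth_on_open U F \<and> (\<forall>P\<in>U \<inter> Sp2. F P = f P))"

text \<open>Derivative of \<open>f\<close> at \<open>Q\<close> in the direction of a tangent vector \<open>v\<close>. The
  Frechet derivative of \<open>f\<close> within \<open>Sp2\<close> is not unique as a map on the ambient space,
  but its values on \<open>T_Sp2 Q\<close> are.\<close>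

definition tderiv :: "(qmat \<Rightarrow> 'b::real_normed_vector) \<Rightarrow> qmat \<Rightarrow> qmat \<Rightarrow> 'b" where
  "tderiv f Q v = (THE d. \<exists>f'. (f has_derivative f') (at Q within Sp2) \<and> f' v = d)"

definition vfield :: "(qmat \<Rightarrow> qmat) \<Rightarrow> bool" where
  "vfield X \<longleftrightarrow> smooth_Sp2 X \<and> (\<forall>Q\<in>Sp2. X Q \<in> T_Sp2 Q)"

definition lie_bracket :: "(qmat \<Rightarrow> qmat) \<Rightarrow> (qmat \<Rightarrow> qmat) \<Rightarrow> qmat \<Rightarrow> qmat" where
  "lie_bracket X Y = (\<lambda>Q. tderiv Y Q (X Q) - tderiv X Q (Y Q))"


section \<open>Levi-Civita connection and curvature\<close>

type_synonym connection = "(qmat \<Rightarrow> qmat) \<Rightarrow> (qmat \<Rightarrow> qmat) \<Rightarrow> qmat \<Rightarrow> qmat"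

definition affine_connection :: "connection \<Rightarrow> bool" where
  "affine_connection D \<longleftrightarrow>
    (\<forall>X Y. vfield X \<longrightarrow> vfield Y \<longrightarrow> vfield (D X Y)) \<and>
    (\<forall>X X' Y. vfield X \<longrightarrow> vfield X' \<longrightarrow> vfield Y \<longrightarrow>
      (\<forall>Q\<in>Sp2. D (\<lambda>P. X P + X' P) Y Q = D X Y Q + D X' Y Q)) \<and>
    (\<forall>X Y Y'. vfield X \<longrightarrow> vfield Y \<longrightarrow> vfield Y' \<longrightarrow>
      (\<forall>Q\<in>Sp2. D X (\<lambda>P. Y P + Y' P) Q = D X Y Q + D X Y' Q)) \<and>
    (\<forall>f X Y. smooth_Sp2 f \<longrightarrow> vfield X \<longrightarrow> vfield Y \<longrightarrow>
      (\<forall>Q\<in>Sp2. D (\<lambda>P. f P *\<^sub>R X P) Y Q = f Q *\<^sub>R D X Y Q)) \<and>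
    (\<forall>f X Y. smooth_Sp2 f \<longrightarrow> vfield X \<longrightarrow> vfield Y \<longrightarrow>
      (\<forall>Q\<in>Sp2. D X (\<lambda>P. f P *\<^sub>R Y P) Q = tderiv f Q (X Q) *\<^sub>R Y Q + f Q *\<^sub>R D X Y Q))"

definition levi_civita :: "metric \<Rightarrow> connection \<Rightarrow> bool" where
  "levi_civita g D \<longleftrightarrow> affine_connection D \<and>
    (\<forall>X Y. vfield X \<longrightarrow> vfield Y \<longrightarrow>
      (\<forall>Q\<in>Sp2. D X Y Q - D Y X Q = lie_bracket X Y Q)) \<and>
    (\<forall>X Y Z. vfield X \<longrightarrow> vfield Y \<longrightarrow> vfield Z \<longrightarrow>
      (\<forall>Q\<in>Sp2. tderiv (\<lambda>P. g P (Y P) (Z P)) Q (X Q) = g Q (D X Y Q) (Z Q) + g Q (Y Q) (D X Z Q)))"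

definition curvature_op :: "connection \<Rightarrow> (qmat \<Rightarrow> qmat) \<Rightarrow> (qmat \<Rightarrow> qmat) \<Rightarrow> (qmat \<Rightarrow> qmat) \<Rightarrow> qmat \<Rightarrow> qmat"
where
  "curvature_op D X Y Z =
    (\<lambda>Q. D X (D Y Z) Q - D Y (D X Z) Q - D (lie_bracket X Y) Z Q)"

text \<open>The curvature tensor \<open>R(u,v)w\<close> at \<open>Q\<close>: extend the tangent vectors to vector fields;
  the value is independent of the extensions.\<close>

definition riemann :: "metric \<Rightarrow> qmat \<Rightarrow> qmat \<Rightarrow> qmat \<Rightarrow> qmat \<Rightarrow> qmat" where
  "riemann g Q u v w =
    (THE a. \<exists>D X Y Z. levi_civita g D \<and> vfield X \<and> vfield Y \<and> vfield Z \<and>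
        X Q = u \<and> Y Q = v \<and> Z Q = w \<and> a = curvature_op D X Y Z Q)"

definition sectional_curvature :: "metric \<Rightarrow> qmat \<Rightarrow> qmat \<Rightarrow> qmat \<Rightarrow> real" where
  "sectional_curvature g Q u v =
    g Q (riemann g Q u v v) u / (g Q u u * g Q v v - (g Q u v)\<^sup>2)"

definition nonneg_sectional_curvature :: "metric \<Rightarrow> bool" where
  "nonneg_sectional_curvature g \<longleftrightarrow>
    (\<forall>Q\<in>Sp2. \<forall>u\<in>T_Sp2 Q. \<forall>v\<in>T_Sp2 Q.
      u \<noteq> v \<and> independent {u, v} \<longrightarrow> sectional_curvature g Q u v \<ge> 0)"

definition orthonormal_basis :: "metric \<Rightarrow> qmat \<Rightarrow> qmat set \<Rightarrow> bool" where
  "orthonormal_basis g Q B \<longleftrightarrow> finite B \<and> span B = T_Sp2 Q \<and>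
    (\<forall>b\<in>B. \<forall>c\<in>B. g Q b c = (if b = c then 1 else 0))"

text \<open>\<open>Ric(v,w)\<close> is the trace of \<open>u \<mapsto> R(u,v)w\<close>, computed in any orthonormal basis
  of the tangent space.\<close>

definition ricci :: "metric \<Rightarrow> qmat \<Rightarrow> qmat \<Rightarrow> qmat \<Rightarrow> real" where
  "ricci g Q v w =
    (THE s. \<exists>B. orthonormal_basis g Q B \<and> s = (\<Sum>b\<in>B. g Q (riemann g Q b v w) b))"

definition einstein :: "metric \<Rightarrow> bool" where
  "einstein g \<longleftrightarrow>
    (\<exists>c::real. \<forall>Q\<in>Sp2. \<forall>v\<in>T_Sp2 Q. \<forall>w\<in>T_Sp2 Q. ricci g Q v w = c * g Q v w)"

end

theory Submission
  imports Defs
begin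

text \<open>Left translation identifies every tangent space of \<open>Sp2\<close> with the Lie algebra \<open>sp2_alg\<close> of
skew-Hermitian matrices, so a vector field \<open>X\<close> is the same as the function
\<open>\<xi> = left_coord X\<close> with values in \<open>sp2_alg\<close>. In these coordinates the metric is a constant
inner product \<open>inner_r\<close>, and the Levi-Civita connection is
\<open>D X Y = Q (d\<eta>(X) + \<Gamma>(\<xi>, \<eta>))\<close> for a constant bilinear product \<open>\<Gamma> = LC_product\<close>: it is free of
torsion and metric because of two identities on the Lie algebra, and the Koszul formula shows that
there is no other such connection. In the curvature operator the derivatives of the coordinate
functions cancel (\<open>tderiv_commutator\<close>, which rests on the symmetry of second derivatives),
and what remains is
\<open>R(A, B) C = \<Gamma>(A, \<Gamma>(B, C)) - \<Gamma>(B, \<Gamma>(A, C)) - \<Gamma>([A, B], C)\<close>, a constant tensor on the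
Lie algebra (\<open>riemann_eq\<close>). Both claims are now questions of quaternionic algebra.

For the sectional curvature, let \<open>A\<close> and \<open>B\<close> have the entries \<open>x1, y1, z1\<close> and \<open>x2, y2, z2\<close>. Put
\<open>X = [x1, x2]\<close>, \<open>Z = [z1, z2]\<close>, \<open>P = y2 y1* - y1 y2*\<close>, \<open>R = y2* y1 - y1* y2\<close> (with \<open>*\<close> the
conjugate), \<open>\<alpha> = x1 y2 - x2 y1\<close> and \<open>\<beta> = y2 z1 - y1 z2\<close>. Then \<open>P\<close> and \<open>R\<close> have equal norms and the
unnormalised curvature \<open>\<langle>R(A, B) B, A\<rangle>\<close> is
\<open>|r1 \<alpha> - r2 \<beta>|^2 / 4 + r1 |X + (3 - 2 r1) P|^2 / 8 + r2 |Z + (3 - 2 r2) R|^2 / 8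
  + ((1 - r1)^3 + (1 - r2)^3) |P|^2 / 2\<close>
(\<open>curvature_sum_of_squares\<close>). It is nonnegative as soon as \<open>(1 - r1)^3 + (1 - r2)^3 \<ge> 0\<close>, that is
\<open>r1 + r2 \<le> 2\<close>. Conversely there is a plane with \<open>P \<noteq> 0\<close> on which the first three squares vanish
(\<open>exists_plane_annihilating_squares\<close>), so the condition is also necessary.

The Ricci form is diagonal: it is \<open>r1^2 + 2\<close>, \<open>12 - 3 (r1 + r2)\<close> and \<open>r2^2 + 2\<close> times the Euclidean
inner product in the \<open>x\<close>, \<open>y\<close> and \<open>z\<close> entries (\<open>ricci_eq\<close>), whereas the metric has the coefficients
\<open>r1 / 2\<close>, \<open>1\<close> and \<open>r2 / 2\<close>. Proportionality is a pair of quadratic equations, and \<open>r1 = r2 = 1\<close> and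
\<open>r1 = r2 = 1 / 2\<close> are their only solutions.\<close>

section \<open>Iterated differentiability\<close>

lemma times_differentiable_on_subset:
  "times_differentiable_on k S f \<Longrightarrow> T \<subseteq> S \<Longrightarrow> times_differentiable_on k T f"
  by (induction k arbitrary: f) (auto intro: continuous_on_subset)

text \<open>The definition speaks of the derivative that \<open>frechet_derivative\<close> chooses at each point; on an open
set it depends only on the values of the function there. This is what allows derivatives to be
replaced by the expressions that the rules of calculus give for them.\<close>

lemma times_differentiable_on_cong:
  assumes "open S" "\<And>x. x \<in> S \<Longrightarrow> f x = g x"
  shows "times_differentiable_on k S f \<longleftrightarrow> times_differentiable_on k S g"
proof -
  have *: "times_differentiable_on k S g"
    if "times_differentiable_on k S f" "\<And>x. x \<in> S \<Longrightarrow> f x = g x" for k f g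
    using that
  proof (induction k arbitrary: f g)
    case 0
    then show ?case by (simp cong: continuous_on_cong)
  next
    case (Suc k)
    have d: "(g has_derivative frechet_derivative f (at x)) (at x)" if "x \<in> S" for x
      using Suc.prems that assms(1)
      by (auto simp: frechet_derivative_works intro: has_derivative_transform_within_open)
    then have e: "frechet_derivative g (at x) = frechet_derivative f (at x)" if "x \<in> S" for x
      using frechet_derivative_at that by metis
    have "times_differentiable_on k S (\<lambda>x. frechet_derivative g (at x) v)" for v
      by (rule Suc.IH[of "\<lambda>x. frechet_derivative f (at x) v"]) (use Suc.prems e in auto)
    then show ?case
      using d by (auto simp: differentiable_def)
  qed
  show ?thesis
    using *[of k f g] *[of k g f] assms(2) by metis
qed

lemma times_differentiable_on_SucD:
  assumes "times_differentiable_on (Suc k) S f"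
  shows "times_differentiable_on k S f"
  using assms
proof (induction k arbitrary: f)
  case 0
  then have "f differentiable_on S"
    by (simp add: differentiable_on_def differentiable_at_withinI)
  then show ?case
    by (simp add: differentiable_imp_continuous_on)
next
  case (Suc k)
  have 1: "\<forall>x\<in>S. f differentiable (at x)"
    and 2: "times_differentiable_on (Suc k) S (\<lambda>x. frechet_derivative f (at x) v)" for v
    using Suc.prems unfolding times_differentiable_on.simps(2)[of "Suc k"] by blast+
  show ?case
    unfolding times_differentiable_on.simps(2)[of k] using 1 Suc.IH[OF 2] by blast
qed

text \<open>The form in which all closure properties are proved: any family of derivatives \<open>f'\<close> may be used.\<close>

lemma times_differentiable_on_SucI:
  assumes "open S" "\<And>x. x \<in> S \<Longrightarrow> (f has_derivative f' x) (at x)"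
    "\<And>v. times_differentiable_on k S (\<lambda>x. f' x v)"
  shows "times_differentiable_on (Suc k) S f"
proof -
  have "frechet_derivative f (at x) = f' x" if "x \<in> S" for x
    using assms(2)[OF that] frechet_derivative_at by metis
  then have "times_differentiable_on k S (\<lambda>x. frechet_derivative f (at x) v)" for v
    using times_differentiable_on_cong[OF assms(1), of "\<lambda>x. frechet_derivative f (at x) v" "\<lambda>x. f' x v"]
      assms(3) by simp
  then show ?thesis
    using assms(2) by (auto simp: differentiable_def)
qed

lemma times_differentiable_on_const:
  assumes "open S"
  shows "times_differentiable_on k S (\<lambda>x. c)"
proof (induction k arbitrary: c)
  case (Suc k)
  then show ?case
    by (intro times_differentiable_on_SucI[where f' = "\<lambda>x v. 0"] assms) auto
qed auto

lemma times_differentiable_on_add: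
  assumes "open S" "times_differentiable_on k S f" "times_differentiable_on k S g"
  shows "times_differentiable_on k S (\<lambda>x. f x + g x)"
  using assms(2,3)
proof (induction k arbitrary: f g)
  case 0
  then show ?case by (auto intro: continuous_intros)
next
  case (Suc k)
  show ?case
    by (rule times_differentiable_on_SucI[OF assms(1), where
          f' = "\<lambda>x v. frechet_derivative f (at x) v + frechet_derivative g (at x) v"])
       (use Suc in \<open>auto simp: frechet_derivative_works intro!: has_derivative_add\<close>)
qed

lemma times_differentiable_on_bilinear:
  assumes "bounded_bilinear h" "open S" "times_differentiable_on k S f" "times_differentiable_on k S g"
  shows "times_differentiable_on k S (\<lambda>x. h (f x) (g x))"
  using assms(3,4)
proof (induction k arbitrary: f g)
  case 0
  then show ?case by (auto intro: bounded_bilinear.continuous_on[OF assms(1)])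
next
  case (Suc k)
  show ?case
  proof (rule times_differentiable_on_SucI[OF assms(2), where
        f' = "\<lambda>x v. h (f x) (frechet_derivative g (at x) v) + h (frechet_derivative f (at x) v) (g x)"])
    show "((\<lambda>x. h (f x) (g x)) has_derivative
      (\<lambda>v. h (f x) (frechet_derivative g (at x) v) + h (frechet_derivative f (at x) v) (g x))) (at x)"
      if "x \<in> S" for x
      using Suc.prems that
      by (auto simp: frechet_derivative_works intro!: bounded_bilinear.FDERIV[OF assms(1)])
    show "times_differentiable_on k S
      (\<lambda>x. h (f x) (frechet_derivative g (at x) v) + h (frechet_derivative f (at x) v) (g x))" for v
      using Suc times_differentiable_on_SucD[OF Suc.prems(1)]
        times_differentiable_on_SucD[OF Suc.prems(2)]
      by (intro times_differentiable_on_add assms(2) Suc.IH) auto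
  qed
qed

lemma times_differentiable_on_linear:
  assumes "bounded_linear h" "open S" "times_differentiable_on k S f"
  shows "times_differentiable_on k S (\<lambda>x. h (f x))"
  using assms(3)
proof (induction k arbitrary: f)
  case 0
  then show ?case by (auto intro: bounded_linear.continuous_on[OF assms(1)])
next
  case (Suc k)
  show ?case
    by (rule times_differentiable_on_SucI[OF assms(2), where
          f' = "\<lambda>x v. h (frechet_derivative f (at x) v)"])
       (use Suc in \<open>auto simp: frechet_derivative_works intro!: bounded_linear.has_derivative[OF assms(1)]\<close>)
qed

lemma times_differentiable_on_ident:
  assumes "open S"
  shows "times_differentiable_on k S (\<lambda>x. x)"
proof (cases k)
  case (Suc k')
  have "times_differentiable_on (Suc k') S (\<lambda>x. x)"
    by (rule times_differentiable_on_SucI[OF assms has_derivative_ident])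
       (rule times_differentiable_on_const[OF assms])
  then show ?thesis by (simp only: Suc)
qed auto

lemma times_differentiable_on_sum:
  assumes "open S" "\<And>i. i \<in> I \<Longrightarrow> times_differentiable_on k S (f i)"
  shows "times_differentiable_on k S (\<lambda>x. \<Sum>i\<in>I. f i x)"
  using assms(2)
  by (induction I rule: infinite_finite_induct)
     (auto intro!: times_differentiable_on_const times_differentiable_on_add assms(1))

section \<open>Symmetry of second derivatives\<close>

text \<open>The mean value theorem is used first along \<open>v\<close> and then along \<open>w\<close>. The second difference on the
left is symmetric in \<open>v\<close> and \<open>w\<close>, so the same number is also a value of the mixed derivative taken in
the other order; letting \<open>s\<close> tend to \<open>0\<close> gives the symmetry of the second derivative.\<close>

lemma second_difference_mean_value:
  fixes f :: "'a::real_normed_vector \<Rightarrow> real"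
  assumes "s > 0"
    and in_S: "\<And>\<sigma> \<tau>. 0 \<le> \<sigma> \<Longrightarrow> \<sigma> \<le> s \<Longrightarrow> 0 \<le> \<tau> \<Longrightarrow> \<tau> \<le> s \<Longrightarrow> x + \<sigma> *\<^sub>R v + \<tau> *\<^sub>R w \<in> S"
    and f: "\<And>p. p \<in> S \<Longrightarrow> f differentiable (at p)"
    and fv: "\<And>p. p \<in> S \<Longrightarrow> (\<lambda>p. frechet_derivative f (at p) v) differentiable (at p)"
  shows "\<exists>\<sigma> \<tau>. 0 < \<sigma> \<and> \<sigma> < s \<and> 0 < \<tau> \<and> \<tau> < s \<and>
    f (x + s *\<^sub>R v + s *\<^sub>R w) - f (x + s *\<^sub>R v) - f (x + s *\<^sub>R w) + f x
      = s\<^sup>2 * frechet_derivative (\<lambda>p. frechet_derivative f (at p) v) (at (x + \<sigma> *\<^sub>R v + \<tau> *\<^sub>R w)) w"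
proof -
  let ?fv = "\<lambda>p. frechet_derivative f (at p) v"
  have d1: "((\<lambda>\<sigma>. f (x + \<sigma> *\<^sub>R v + \<tau> *\<^sub>R w)) has_real_derivative ?fv (x + \<sigma> *\<^sub>R v + \<tau> *\<^sub>R w)) (at \<sigma>)"
    if "0 \<le> \<sigma>" "\<sigma> \<le> s" "0 \<le> \<tau>" "\<tau> \<le> s" for \<sigma> \<tau>
  proof -
    have D: "(f has_derivative frechet_derivative f (at (x + \<sigma> *\<^sub>R v + \<tau> *\<^sub>R w))) (at (x + \<sigma> *\<^sub>R v + \<tau> *\<^sub>R w))"
      using f in_S that by (simp add: frechet_derivative_works)
    have "((\<lambda>\<sigma>. f (x + \<sigma> *\<^sub>R v + \<tau> *\<^sub>R w)) has_derivative
        (\<lambda>h. frechet_derivative f (at (x + \<sigma> *\<^sub>R v + \<tau> *\<^sub>R w)) (h *\<^sub>R v))) (at \<sigma>)"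
      by (rule has_derivative_compose[where f = "\<lambda>\<sigma>. x + \<sigma> *\<^sub>R v + \<tau> *\<^sub>R w", OF _ D]) (auto intro!: derivative_eq_intros)
    then show ?thesis
      using linear_scale[OF has_derivative_linear[OF D]]
      by (simp add: has_field_derivative_def mult_commute_abs)
  qed
  have d2: "((\<lambda>\<tau>. ?fv (x + \<sigma> *\<^sub>R v + \<tau> *\<^sub>R w)) has_real_derivative
      frechet_derivative ?fv (at (x + \<sigma> *\<^sub>R v + \<tau> *\<^sub>R w)) w) (at \<tau>)"
    if "0 \<le> \<sigma>" "\<sigma> \<le> s" "0 \<le> \<tau>" "\<tau> \<le> s" for \<sigma> \<tau>
  proof -
    have D: "(?fv has_derivative frechet_derivative ?fv (at (x + \<sigma> *\<^sub>R v + \<tau> *\<^sub>R w))) (at (x + \<sigma> *\<^sub>R v + \<tau> *\<^sub>R w))"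
      using fv in_S that by (simp add: frechet_derivative_works)
    have "((\<lambda>\<tau>. ?fv (x + \<sigma> *\<^sub>R v + \<tau> *\<^sub>R w)) has_derivative
        (\<lambda>h. frechet_derivative ?fv (at (x + \<sigma> *\<^sub>R v + \<tau> *\<^sub>R w)) (h *\<^sub>R w))) (at \<tau>)"
      by (rule has_derivative_compose[where f = "\<lambda>\<tau>. x + \<sigma> *\<^sub>R v + \<tau> *\<^sub>R w", OF _ D]) (auto intro!: derivative_eq_intros)
    then show ?thesis
      using linear_scale[OF has_derivative_linear[OF D]]
      by (simp add: has_field_derivative_def mult_commute_abs)
  qed
  define g where "g \<sigma> = f (x + \<sigma> *\<^sub>R v + s *\<^sub>R w) - f (x + \<sigma> *\<^sub>R v + 0 *\<^sub>R w)" for \<sigma>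
  have "\<exists>\<sigma>>0. \<sigma> < s \<and> g s - g 0 = (s - 0) * (?fv (x + \<sigma> *\<^sub>R v + s *\<^sub>R w) - ?fv (x + \<sigma> *\<^sub>R v + 0 *\<^sub>R w))"
    unfolding g_def using assms(1) by (intro MVT2 DERIV_diff d1) auto
  then obtain \<sigma> where \<sigma>: "0 < \<sigma>" "\<sigma> < s"
    and g: "g s - g 0 = s * (?fv (x + \<sigma> *\<^sub>R v + s *\<^sub>R w) - ?fv (x + \<sigma> *\<^sub>R v + 0 *\<^sub>R w))" by auto
  have "\<exists>\<tau>>0. \<tau> < s \<and> ?fv (x + \<sigma> *\<^sub>R v + s *\<^sub>R w) - ?fv (x + \<sigma> *\<^sub>R v + 0 *\<^sub>R w)
      = (s - 0) * frechet_derivative ?fv (at (x + \<sigma> *\<^sub>R v + \<tau> *\<^sub>R w)) w"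
    using assms(1) \<sigma> by (intro MVT2 d2) auto
  then obtain \<tau> where \<tau>: "0 < \<tau>" "\<tau> < s"
    "?fv (x + \<sigma> *\<^sub>R v + s *\<^sub>R w) - ?fv (x + \<sigma> *\<^sub>R v + 0 *\<^sub>R w)
      = s * frechet_derivative ?fv (at (x + \<sigma> *\<^sub>R v + \<tau> *\<^sub>R w)) w" by auto
  have "f (x + s *\<^sub>R v + s *\<^sub>R w) - f (x + s *\<^sub>R v) - f (x + s *\<^sub>R w) + f x = g s - g 0"
    by (simp add: g_def)
  also have "\<dots> = s\<^sup>2 * frechet_derivative ?fv (at (x + \<sigma> *\<^sub>R v + \<tau> *\<^sub>R w)) w"
    unfolding g \<tau>(3) by (simp add: power2_eq_square)
  finally show ?thesis using \<sigma> \<tau>(1,2) by blast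
qed

lemma second_derivative_symmetric_real:
  fixes f :: "'a::real_normed_vector \<Rightarrow> real"
  assumes "open S" "times_differentiable_on 2 S f" "x \<in> S"
  shows "frechet_derivative (\<lambda>p. frechet_derivative f (at p) v) (at x) w
       = frechet_derivative (\<lambda>p. frechet_derivative f (at p) w) (at x) v"
proof -
  define H where "H v w p = frechet_derivative (\<lambda>p. frechet_derivative f (at p) v) (at p) w" for v w p
  have f: "f differentiable (at p)" and fv: "(\<lambda>p. frechet_derivative f (at p) v) differentiable (at p)"
    if "p \<in> S" for p v
    using assms(2) that by (auto simp: numeral_2_eq_2)
  have cont: "continuous_on S (H v w)" for v w
    using assms(2) by (auto simp: numeral_2_eq_2 H_def)
  have "\<bar>H v w x - H w v x\<bar> \<le> e" if "e > 0" for e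
  proof -
    have "\<exists>d>0. \<forall>p. dist p x < d \<longrightarrow> p \<in> S \<and> dist (H v w p) (H v w x) < e / 2 \<and> dist (H w v p) (H w v x) < e / 2"
    proof -
      have "\<forall>\<^sub>F p in nhds x. p \<in> S"
        using assms(1,3) by (rule eventually_nhds_in_open)
      moreover have "\<forall>\<^sub>F p in nhds x. dist (H v w p) (H v w x) < e / 2" for v w
      proof -
        have "isCont (H v w) x"
          using cont assms(1,3) by (simp add: continuous_on_eq_continuous_at)
        then have "(H v w \<longlongrightarrow> H v w x) (nhds x)"
          by (simp add: continuous_at tendsto_at_iff_tendsto_nhds)
        then show ?thesis
          using \<open>e > 0\<close> by (intro tendstoD) auto
      qed
      ultimately have "\<forall>\<^sub>F p in nhds x. p \<in> S \<and> dist (H v w p) (H v w x) < e / 2 \<and> dist (H w v p) (H w v x) < e / 2"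
        by (intro eventually_conj)
      then show ?thesis
        by (simp add: eventually_nhds_metric)
    qed
    then obtain d where d: "d > 0" "\<And>p. dist p x < d \<Longrightarrow> p \<in> S"
      "\<And>p. dist p x < d \<Longrightarrow> dist (H v w p) (H v w x) < e / 2"
      "\<And>p. dist p x < d \<Longrightarrow> dist (H w v p) (H w v x) < e / 2" by blast
    \<comment> \<open>small enough for the parallelogram spanned by \<open>s v\<close> and \<open>s w\<close> to stay within distance \<open>d\<close>\<close>
    define s where "s = d / (1 + norm v + norm w)"
    have N: "1 + norm v + norm w > 0" by (simp add: add_pos_nonneg)
    have "s > 0" using d(1) N by (simp add: s_def)
    have near: "dist (x + \<sigma> *\<^sub>R v + \<tau> *\<^sub>R w) x < d"
      if "0 \<le> \<sigma>" "\<sigma> \<le> s" "0 \<le> \<tau>" "\<tau> \<le> s" for \<sigma> \<tau>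
    proof -
      have "dist (x + \<sigma> *\<^sub>R v + \<tau> *\<^sub>R w) x = norm (\<sigma> *\<^sub>R v + \<tau> *\<^sub>R w)"
        by (simp add: dist_norm add.assoc)
      also have "\<dots> \<le> \<sigma> * norm v + \<tau> * norm w"
        using that norm_triangle_ineq[of "\<sigma> *\<^sub>R v" "\<tau> *\<^sub>R w"] by simp
      also have "\<dots> \<le> s * norm v + s * norm w"
        using that by (intro add_mono mult_right_mono) auto
      also have "\<dots> < s * (1 + norm v + norm w)"
        using \<open>s > 0\<close> by (simp add: algebra_simps)
      also have "\<dots> = d" using N by (simp add: s_def)
      finally show ?thesis .
    qed
    define \<Delta> where "\<Delta> = f (x + s *\<^sub>R v + s *\<^sub>R w) - f (x + s *\<^sub>R v) - f (x + s *\<^sub>R w) + f x"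
    obtain \<sigma> \<tau> where 1: "0 < \<sigma>" "\<sigma> < s" "0 < \<tau>" "\<tau> < s" "\<Delta> = s\<^sup>2 * H v w (x + \<sigma> *\<^sub>R v + \<tau> *\<^sub>R w)"
      using second_difference_mean_value[of s x v w S f, OF \<open>s > 0\<close> d(2)[OF near] f fv]
      unfolding \<Delta>_def H_def by blast
    have near': "dist (x + \<sigma> *\<^sub>R w + \<tau> *\<^sub>R v) x < d"
      if "0 \<le> \<sigma>" "\<sigma> \<le> s" "0 \<le> \<tau>" "\<tau> \<le> s" for \<sigma> \<tau>
      using near[of \<tau> \<sigma>] that by (simp add: add_ac)
    have "\<Delta> = f (x + s *\<^sub>R w + s *\<^sub>R v) - f (x + s *\<^sub>R w) - f (x + s *\<^sub>R v) + f x"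
      by (simp add: \<Delta>_def add_ac)
    then obtain \<sigma>' \<tau>' where 2: "0 < \<sigma>'" "\<sigma>' < s" "0 < \<tau>'" "\<tau>' < s" "\<Delta> = s\<^sup>2 * H w v (x + \<sigma>' *\<^sub>R w + \<tau>' *\<^sub>R v)"
      using second_difference_mean_value[of s x w v S f, OF \<open>s > 0\<close> d(2)[OF near'] f fv]
      unfolding H_def by auto
    have "H v w (x + \<sigma> *\<^sub>R v + \<tau> *\<^sub>R w) = H w v (x + \<sigma>' *\<^sub>R w + \<tau>' *\<^sub>R v)"
      using 1(5) 2(5) \<open>s > 0\<close> by simp
    then show ?thesis
      using d(3)[OF near[of \<sigma> \<tau>]] d(4)[OF near'[of \<sigma>' \<tau>']] 1 2
      unfolding dist_real_def by linarith
  qed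
  then have "\<bar>H v w x - H w v x\<bar> \<le> 0"
    by (rule field_le_epsilon) simp
  then show ?thesis by (simp add: H_def)
qed

text \<open>The real case applied to all functions \<open>\<lambda>p. f p \<bullet> c\<close>.\<close>

lemma second_derivative_symmetric:
  fixes f :: "'a::real_normed_vector \<Rightarrow> 'b::real_inner"
  assumes "open S" "times_differentiable_on 2 S f" "x \<in> S"
  shows "frechet_derivative (\<lambda>p. frechet_derivative f (at p) v) (at x) w
       = frechet_derivative (\<lambda>p. frechet_derivative f (at p) w) (at x) v"
proof -
  have "frechet_derivative (\<lambda>p. frechet_derivative f (at p) v) (at x) w \<bullet> c
       = frechet_derivative (\<lambda>p. frechet_derivative f (at p) w) (at x) v \<bullet> c" for c
  proof -
    have inner_deriv: "frechet_derivative (\<lambda>p. g p \<bullet> c) (at p) = (\<lambda>u. frechet_derivative g (at p) u \<bullet> c)"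
      if "g differentiable (at p)" for g :: "'a \<Rightarrow> 'b" and p
      using that unfolding frechet_derivative_works
      by (intro frechet_derivative_at[symmetric] has_derivative_inner_left)
    have d: "f differentiable (at p)" "(\<lambda>p. frechet_derivative f (at p) v) differentiable (at p)" if "p \<in> S" for p v
      using assms(2) that by (auto simp: numeral_2_eq_2)
    have "frechet_derivative (\<lambda>p. frechet_derivative (\<lambda>p. f p \<bullet> c) (at p) v) (at x) w
      = frechet_derivative (\<lambda>p. frechet_derivative f (at p) v) (at x) w \<bullet> c" for v w
    proof -
      have "((\<lambda>p. frechet_derivative f (at p) v \<bullet> c) has_derivative
          (\<lambda>w. frechet_derivative (\<lambda>p. frechet_derivative f (at p) v) (at x) w \<bullet> c)) (at x)"
        using d(2)[OF assms(3)] unfolding frechet_derivative_works by (intro has_derivative_inner_left)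
      then have "((\<lambda>p. frechet_derivative (\<lambda>p. f p \<bullet> c) (at p) v) has_derivative
          (\<lambda>w. frechet_derivative (\<lambda>p. frechet_derivative f (at p) v) (at x) w \<bullet> c)) (at x)"
        by (rule has_derivative_transform_within_open[OF _ assms(1,3)]) (simp add: inner_deriv d)
      then show ?thesis
        using frechet_derivative_at by metis
    qed
    moreover have "times_differentiable_on 2 S (\<lambda>p. f p \<bullet> c)"
      by (rule times_differentiable_on_linear[OF bounded_linear_inner_left assms(1,2)])
    ultimately show ?thesis
      using second_derivative_symmetric_real[OF assms(1) _ assms(3), of "\<lambda>p. f p \<bullet> c" v w] by simp
  qed
  then show ?thesis
    by (metis vector_eq_rdot)
qed

section \<open>Tangent vectors of the group\<close>

lemma bounded_bilinear_qmat_mult: "bounded_bilinear (\<lambda>A B :: qmat. A ** B)"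
  unfolding bilinear_conv_bounded_bilinear[symmetric] bilinear_def
  by (auto intro!: linearI simp: vec_eq_iff matrix_matrix_mult_def sum.distrib distrib_left
      distrib_right scaleR_sum_right)

lemmas qmat_mult_simps =
  bounded_bilinear.add_left[OF bounded_bilinear_qmat_mult]
  bounded_bilinear.add_right[OF bounded_bilinear_qmat_mult]
  bounded_bilinear.diff_left[OF bounded_bilinear_qmat_mult]
  bounded_bilinear.diff_right[OF bounded_bilinear_qmat_mult]
  bounded_bilinear.minus_left[OF bounded_bilinear_qmat_mult]
  bounded_bilinear.minus_right[OF bounded_bilinear_qmat_mult]
  bounded_bilinear.scaleR_left[OF bounded_bilinear_qmat_mult]
  bounded_bilinear.scaleR_right[OF bounded_bilinear_qmat_mult]

lemma bounded_linear_qadj: "bounded_linear qadj"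
  unfolding linear_conv_bounded_linear[symmetric]
  by (rule linearI) (simp_all add: qadj_def vec_eq_iff quat_eq_iff)

lemmas qadj_simps =
  linear_add[OF bounded_linear.linear[OF bounded_linear_qadj]]
  linear_diff[OF bounded_linear.linear[OF bounded_linear_qadj]]
  linear_neg[OF bounded_linear.linear[OF bounded_linear_qadj]]
  linear_scale[OF bounded_linear.linear[OF bounded_linear_qadj]]

lemma qadj_mat_1: "qadj (mat 1) = mat 1"
  by (auto simp: qadj_def mat_def vec_eq_iff quat_eq_iff)

lemma mat_1_in_Sp2: "mat 1 \<in> Sp2"
  by (simp add: Sp2_def qadj_mat_1)

lemma qcnj_0: "qcnj 0 = 0"
  by (simp add: quat_eq_iff)

text \<open>The Lie algebra of \<open>Sp2\<close>, as the kernel of the linear map that sends \<open>A\<close> to \<open>qadj A + A\<close>.\<close>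

definition sp2_alg :: "qmat set" where
  "sp2_alg = {A. qadj A = - A}"

lemma qmat_eq_iff: "A = B \<longleftrightarrow> A $ 1 $ 1 = B $ 1 $ 1 \<and> A $ 1 $ 2 = B $ 1 $ 2 \<and> A $ 2 $ 1 = B $ 2 $ 1 \<and> A $ 2 $ 2 = B $ 2 $ 2"
  for A B :: qmat
  by (auto simp: vec_eq_iff forall_2)

lemma sp2_mat_nth [simp]:
  "sp2_mat x y z $ 1 $ 1 = x" "sp2_mat x y z $ 1 $ 2 = y"
  "sp2_mat x y z $ 2 $ 1 = - qcnj y" "sp2_mat x y z $ 2 $ 2 = z"
  by (simp_all add: sp2_mat_def)

lemma sp2_mat_in_alg: "qRe x = 0 \<Longrightarrow> qRe z = 0 \<Longrightarrow> sp2_mat x y z \<in> sp2_alg"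
  by (simp add: sp2_alg_def qmat_eq_iff qadj_def quat_eq_iff)

lemma sp2_algE:
  assumes "A \<in> sp2_alg"
  obtains x y z where "A = sp2_mat x y z" "qRe x = 0" "qRe z = 0"
proof
  have e: "qcnj (A $ i $ j) = - (A $ j $ i)" for i j
  proof -
    have "qadj A $ j $ i = (- A) $ j $ i"
      using assms by (simp add: sp2_alg_def)
    then show ?thesis by (simp add: qadj_def)
  qed
  have "- qcnj (A $ 1 $ 2) = A $ 2 $ 1"
    unfolding e by simp
  then show "A = sp2_mat (A $ 1 $ 1) (A $ 1 $ 2) (A $ 2 $ 2)"
    by (simp add: qmat_eq_iff)
  show "qRe (A $ 1 $ 1) = 0" "qRe (A $ 2 $ 2) = 0"
    using arg_cong[OF e[of 1 1], of qRe] arg_cong[OF e[of 2 2], of qRe] by simp_all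
qed

lemma subspace_sp2_alg: "subspace sp2_alg"
  by (auto simp: subspace_def sp2_alg_def qadj_simps linear_0[OF bounded_linear.linear[OF bounded_linear_qadj]])

lemma T_Sp2_eq: "T_Sp2 Q = (\<lambda>A. Q ** A) ` sp2_alg"
  by (auto simp: T_Sp2_def sp2_mat_in_alg elim!: sp2_algE)

lemma Sp2_cancel_left: "Q \<in> Sp2 \<Longrightarrow> qadj Q ** (Q ** A) = A"
  by (simp add: matrix_mul_assoc Sp2_adj_left)

lemma Sp2_cancel_right: "Q \<in> Sp2 \<Longrightarrow> Q ** (qadj Q ** A) = A"
  by (simp add: matrix_mul_assoc Sp2_def)

lemma mem_T_Sp2_iff: "Q \<in> Sp2 \<Longrightarrow> U \<in> T_Sp2 Q \<longleftrightarrow> qadj Q ** U \<in> sp2_alg"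
  unfolding T_Sp2_eq by (metis (no_types, lifting) Sp2_cancel_left Sp2_cancel_right image_iff)

lemma subspace_T_Sp2: "subspace (T_Sp2 Q)"
  unfolding T_Sp2_eq
  by (rule linear_subspace_image[OF _ subspace_sp2_alg])
     (auto intro!: linearI simp: qmat_mult_simps)

text \<open>If \<open>S\<^sup>3 = - S\<close>, then the exponential series of \<open>t S\<close> sums to \<open>1 + sin t S + (1 - cos t) S\<^sup>2\<close>
(the formula of Rodrigues). This gives explicit curves in the group through every point.\<close>

lemma Rodrigues_curve_in_Sp2:
  assumes "Q \<in> Sp2" "S \<in> sp2_alg" "S ** (S ** S) = - S"
  shows "Q ** (mat 1 + sin t *\<^sub>R S + (1 - cos t) *\<^sub>R (S ** S)) \<in> Sp2"
proof -
  let ?R = "mat 1 + sin t *\<^sub>R S + (1 - cos t) *\<^sub>R (S ** S)"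
  have S: "qadj S = - S" "S ** (S ** (S ** X)) = - (S ** X)" for X :: qmat
    using assms(2,3) by (simp_all add: sp2_alg_def matrix_mul_assoc qmat_mult_simps)
  have adj: "qadj ?R = mat 1 - sin t *\<^sub>R S + (1 - cos t) *\<^sub>R (S ** S)"
    by (simp add: qadj_simps qadj_mult qadj_mat_1 S qmat_mult_simps)
  have "cos t * cos t + sin t * sin t = 1"
    using sin_cos_squared_add2[of t] by (simp add: power2_eq_square)
  then have R: "?R ** qadj ?R = mat 1"
    unfolding adj
    by (simp add: qmat_mult_simps matrix_mul_assoc[symmetric] S assms(3) algebra_simps
        flip: scaleR_2) (simp flip: scaleR_add_left)
  have "(Q ** ?R) ** qadj (Q ** ?R) = Q ** ((?R ** qadj ?R) ** qadj Q)"
    by (simp only: qadj_mult matrix_mul_assoc)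
  also have "\<dots> = mat 1"
    using assms(1) by (simp add: R Sp2_def)
  finally show ?thesis by (simp add: Sp2_def)
qed

lemma derivative_within_Sp2_unique_along:
  assumes "Q \<in> Sp2" "S \<in> sp2_alg" "S ** (S ** S) = - S"
    "(f has_derivative f') (at Q within Sp2)" "(f has_derivative f'') (at Q within Sp2)"
  shows "f' (Q ** S) = f'' (Q ** S)"
proof -
  \<comment> \<open>a curve in the group with velocity \<open>Q ** S\<close> at time \<open>0\<close>\<close>
  define \<gamma> where "\<gamma> t = Q ** (mat 1 + sin t *\<^sub>R S + (1 - cos t) *\<^sub>R (S ** S))" for t
  have \<gamma>: "\<gamma> = (\<lambda>t. Q + sin t *\<^sub>R (Q ** S) + (1 - cos t) *\<^sub>R (Q ** (S ** S)))"
    by (simp add: \<gamma>_def qmat_mult_simps fun_eq_iff)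
  have "(\<gamma> has_derivative (\<lambda>t. t *\<^sub>R (Q ** S))) (at 0)"
    unfolding \<gamma> by (auto intro!: derivative_eq_intros)
  moreover have "((\<lambda>t. f (\<gamma> t)) has_derivative (\<lambda>t. g (t *\<^sub>R (Q ** S)))) (at 0)"
    if "(f has_derivative g) (at Q within Sp2)" for g
  proof -
    have "(f has_derivative g) (at (\<gamma> 0) within range \<gamma>)"
      using has_derivative_subset[OF that, of "range \<gamma>"] Rodrigues_curve_in_Sp2[OF assms(1-3)]
      by (auto simp: \<gamma>_def)
    then show ?thesis
      using calculation has_derivative_in_compose by blast
  qed
  from has_derivative_unique[OF this[OF assms(4)] this[OF assms(5)]]
  have "(\<lambda>t. f' (t *\<^sub>R (Q ** S))) = (\<lambda>t. f'' (t *\<^sub>R (Q ** S)))" .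
  from fun_cong[OF this, of 1] show ?thesis by simp
qed

lemma imaginary_unit_square: "u * u = - 1" if "qRe u = 0" "norm u = 1" for u :: quat
proof -
  have "qcnj u = - u" using that by (simp add: quat_eq_iff)
  then show ?thesis using mult_qcnj(1)[of u] that(2) by (simp add: minus_equation_iff)
qed

text \<open>The curves above exhaust the tangent directions up to linear combinations. Unit vectors in the three
entries satisfy the cubic equation: \<open>u * u = - 1\<close> for an imaginary unit \<open>u\<close>, and
\<open>v * (qcnj v * v) = v\<close> for any unit \<open>v\<close>.\<close>

lemma sp2_alg_decompose:
  assumes "A \<in> sp2_alg"
  obtains a b c S1 S2 S3 where "A = a *\<^sub>R S1 + b *\<^sub>R S2 + c *\<^sub>R S3"
    "\<And>S. S \<in> {S1, S2, S3} \<Longrightarrow> S \<in> sp2_alg \<and> S ** (S ** S) = - S"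
proof -
  obtain x y z where A: "A = sp2_mat x y z" "qRe x = 0" "qRe z = 0"
    using assms by (rule sp2_algE)
  have pure: "\<exists>a u. qRe u = 0 \<and> u * (u * u) = - u \<and> x = a *\<^sub>R u" if "qRe x = 0" for x
  proof (cases "x = 0")
    case False
    have "qRe (sgn x) = 0" "norm (sgn x) = 1" "x = norm x *\<^sub>R sgn x"
      using that False by (simp_all add: sgn_quat_def norm_sgn)
    then show ?thesis
      using imaginary_unit_square[of "sgn x"] by (intro exI[of _ "norm x"] exI[of _ "sgn x"]) simp
  qed (rule exI[of _ 0], rule exI[of _ 0], simp)
  obtain a u where u: "qRe u = 0" "u * (u * u) = - u" "x = a *\<^sub>R u"
    using pure[OF A(2)] by blast
  obtain c w where w: "qRe w = 0" "w * (w * w) = - w" "z = c *\<^sub>R w"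
    using pure[OF A(3)] by blast
  obtain b v where v: "(norm v)\<^sup>2 *\<^sub>R v = v" "y = b *\<^sub>R v"
  proof (cases "y = 0")
    case True
    then show ?thesis using that[of 0 0] by simp
  next
    case False
    then show ?thesis using that[of "sgn y" "norm y"] by (simp add: norm_sgn sgn_quat_def)
  qed
  have v': "v * (qcnj v * v) = v" "qcnj v * (v * qcnj v) = qcnj v"
  proof -
    show "v * (qcnj v * v) = v" using v(1) by (simp add: mult_qcnj)
    have "(norm v)\<^sup>2 *\<^sub>R qcnj v = qcnj ((norm v)\<^sup>2 *\<^sub>R v)" by (simp add: quat_eq_iff)
    then have "(norm v)\<^sup>2 *\<^sub>R qcnj v = qcnj v" by (simp only: v(1))
    then show "qcnj v * (v * qcnj v) = qcnj v" by (simp add: mult_qcnj)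
  qed
  show ?thesis
  proof
    show "A = a *\<^sub>R sp2_mat u 0 0 + b *\<^sub>R sp2_mat 0 v 0 + c *\<^sub>R sp2_mat 0 0 w"
      by (simp add: A(1) u(3) v(2) w(3) qmat_eq_iff qcnj_0) (simp add: quat_eq_iff)
    have "sp2_mat u 0 0 ** (sp2_mat u 0 0 ** sp2_mat u 0 0) = - sp2_mat u 0 0"
      "sp2_mat 0 0 w ** (sp2_mat 0 0 w ** sp2_mat 0 0 w) = - sp2_mat 0 0 w"
      "sp2_mat 0 v 0 ** (sp2_mat 0 v 0 ** sp2_mat 0 v 0) = - sp2_mat 0 v 0"
      using u(2) w(2) v'
      by (simp_all add: qmat_eq_iff matrix_matrix_mult_def sum_2 qcnj_0)
    then show "S \<in> sp2_alg \<and> S ** (S ** S) = - S" if "S \<in> {sp2_mat u 0 0, sp2_mat 0 v 0, sp2_mat 0 0 w}" for S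
      using that u(1) w(1) by (auto simp: sp2_mat_in_alg)
  qed
qed

text \<open>A derivative within \<open>Sp2\<close> is determined along the curves in the group, hence on all of the tangent
space by linearity.\<close>

lemma derivative_within_Sp2_unique:
  assumes "Q \<in> Sp2" "v \<in> T_Sp2 Q"
    "(f has_derivative f') (at Q within Sp2)" "(f has_derivative f'') (at Q within Sp2)"
  shows "f' v = f'' v"
proof -
  obtain A where A: "A \<in> sp2_alg" "v = Q ** A"
    using assms(2) by (auto simp: T_Sp2_eq)
  obtain a b c S1 S2 S3 where d: "A = a *\<^sub>R S1 + b *\<^sub>R S2 + c *\<^sub>R S3"
    "\<And>S. S \<in> {S1, S2, S3} \<Longrightarrow> S \<in> sp2_alg \<and> S ** (S ** S) = - S"
    using sp2_alg_decompose[OF A(1)] by metis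
  have "f' (Q ** S) = f'' (Q ** S)" if "S \<in> {S1, S2, S3}" for S
    using derivative_within_Sp2_unique_along assms d(2)[OF that] by blast
  then show ?thesis
    using has_derivative_linear[OF assms(3)] has_derivative_linear[OF assms(4)]
    by (simp add: A(2) d(1) qmat_mult_simps linear_add linear_scale)
qed

text \<open>The definite description in \<open>tderiv\<close> thus denotes the derivative; from here on it is computed by
exhibiting any derivative within \<open>Sp2\<close>.\<close>

lemma tderiv_eq:
  assumes "(f has_derivative f') (at Q within Sp2)" "Q \<in> Sp2" "v \<in> T_Sp2 Q"
  shows "tderiv f Q v = f' v"
  unfolding tderiv_def
  using assms derivative_within_Sp2_unique[OF assms(2,3)] by (intro the_equality) blast+

section \<open>Smooth functions and vector fields\<close>

text \<open>Everything about smooth functions on \<open>Sp2\<close> is read off from local extensions \<open>F\<close> to the ambient space: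
in tangential directions \<open>tderiv f\<close> is the ordinary derivative of \<open>F\<close>, at all points of \<open>Sp2\<close> near \<open>Q\<close>.\<close>

lemma smooth_Sp2_extension:
  assumes "smooth_Sp2 f" "Q \<in> Sp2"
  obtains U F where "Q \<in> U" "open U" "\<And>k. times_differentiable_on k U F"
    "\<And>P. P \<in> U \<Longrightarrow> P \<in> Sp2 \<Longrightarrow> F P = f P"
    "\<And>P. P \<in> U \<Longrightarrow> P \<in> Sp2 \<Longrightarrow> (f has_derivative frechet_derivative F (at P)) (at P within Sp2)"
    "\<And>P v. P \<in> U \<Longrightarrow> P \<in> Sp2 \<Longrightarrow> v \<in> T_Sp2 P \<Longrightarrow> tderiv f P v = frechet_derivative F (at P) v"
proof -
  obtain U F where U: "Q \<in> U" "open U" "\<And>k. times_differentiable_on k U F"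
    and eq: "\<And>P. P \<in> U \<Longrightarrow> P \<in> Sp2 \<Longrightarrow> F P = f P"
    using bspec[OF assms(1)[unfolded smooth_Sp2_def smooth_on_open_def] assms(2)]
    by (elim exE conjE) blast
  have d: "(f has_derivative frechet_derivative F (at P)) (at P within Sp2)" if "P \<in> U" "P \<in> Sp2" for P
  proof -
    have "F differentiable (at P)"
      using U(3)[of 1] that by simp
    then have "(F has_derivative frechet_derivative F (at P)) (at P within Sp2)"
      by (simp add: frechet_derivative_works has_derivative_at_withinI)
    moreover have "\<forall>\<^sub>F x in at P within Sp2. F x = f x"
      using eventually_nhds_in_open[OF U(2) \<open>P \<in> U\<close>] eq
      by (auto simp: eventually_at_filter elim: eventually_mono)
    ultimately show ?thesis
      using that eq has_derivative_transform_eventually by blast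
  qed
  show ?thesis
    by (rule that[OF U eq d]) (auto intro: tderiv_eq d)
qed

lemma smooth_Sp2I:
  assumes "\<And>Q. Q \<in> Sp2 \<Longrightarrow> \<exists>U F. Q \<in> U \<and> open U \<and> (\<forall>k. times_differentiable_on k U F) \<and> (\<forall>P\<in>U \<inter> Sp2. F P = f P)"
  shows "smooth_Sp2 f"
  unfolding smooth_Sp2_def smooth_on_open_def
proof
  fix Q assume "Q \<in> Sp2"
  from assms[OF this] show "\<exists>U F. Q \<in> U \<and> (open U \<and> (\<forall>k. times_differentiable_on k U F)) \<and> (\<forall>P\<in>U \<inter> Sp2. F P = f P)"
    by (elim exE) (intro exI, simp)
qed

lemma smooth_Sp2_cong:
  assumes "smooth_Sp2 f" "\<And>P. P \<in> Sp2 \<Longrightarrow> f P = g P"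
  shows "smooth_Sp2 g"
  using assms unfolding smooth_Sp2_def by (metis Int_iff)

lemma smooth_Sp2_const: "smooth_Sp2 (\<lambda>P. c)"
  by (rule smooth_Sp2I, rule exI[of _ UNIV], rule exI[of _ "\<lambda>P. c"])
     (simp add: times_differentiable_on_const)

lemma smooth_Sp2_ident: "smooth_Sp2 (\<lambda>P. P)"
  by (rule smooth_Sp2I, rule exI[of _ UNIV], rule exI[of _ "\<lambda>P. P"])
     (simp add: times_differentiable_on_ident)

lemma smooth_Sp2_linear:
  assumes "bounded_linear h" "smooth_Sp2 f"
  shows "smooth_Sp2 (\<lambda>P. h (f P))"
proof (rule smooth_Sp2I)
  fix Q assume "Q \<in> Sp2"
  obtain U F where "Q \<in> U" "open U" "\<And>k. times_differentiable_on k U F"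
    "\<And>P. P \<in> U \<Longrightarrow> P \<in> Sp2 \<Longrightarrow> F P = f P"
    using smooth_Sp2_extension[OF assms(2) \<open>Q \<in> Sp2\<close>] by metis
  then show "\<exists>U F. Q \<in> U \<and> open U \<and> (\<forall>k. times_differentiable_on k U F) \<and> (\<forall>P\<in>U \<inter> Sp2. F P = h (f P))"
    by (intro exI[of _ U] exI[of _ "\<lambda>P. h (F P)"]) (auto intro: times_differentiable_on_linear[OF assms(1)])
qed

lemma smooth_Sp2_bilinear:
  assumes "bounded_bilinear h" "smooth_Sp2 f" "smooth_Sp2 g"
  shows "smooth_Sp2 (\<lambda>P. h (f P) (g P))"
proof (rule smooth_Sp2I)
  fix Q assume "Q \<in> Sp2"
  obtain U F where U: "Q \<in> U" "open U" "\<And>k. times_differentiable_on k U F"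
    "\<And>P. P \<in> U \<Longrightarrow> P \<in> Sp2 \<Longrightarrow> F P = f P"
    using smooth_Sp2_extension[OF assms(2) \<open>Q \<in> Sp2\<close>] by metis
  obtain V G where V: "Q \<in> V" "open V" "\<And>k. times_differentiable_on k V G"
    "\<And>P. P \<in> V \<Longrightarrow> P \<in> Sp2 \<Longrightarrow> G P = g P"
    using smooth_Sp2_extension[OF assms(3) \<open>Q \<in> Sp2\<close>] by metis
  have "times_differentiable_on k (U \<inter> V) (\<lambda>P. h (F P) (G P))" for k
    using U V by (intro times_differentiable_on_bilinear[OF assms(1)] open_Int)
      (auto intro: times_differentiable_on_subset)
  then show "\<exists>U F. Q \<in> U \<and> open U \<and> (\<forall>k. times_differentiable_on k U F) \<and> (\<forall>P\<in>U \<inter> Sp2. F P = h (f P) (g P))"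
    using U V by (intro exI[of _ "U \<inter> V"] exI[of _ "\<lambda>P. h (F P) (G P)"]) auto
qed

lemma smooth_Sp2_add:
  assumes "smooth_Sp2 f" "smooth_Sp2 g"
  shows "smooth_Sp2 (\<lambda>P. f P + g P)"
proof (rule smooth_Sp2I)
  fix Q assume "Q \<in> Sp2"
  obtain U F where U: "Q \<in> U" "open U" "\<And>k. times_differentiable_on k U F"
    "\<And>P. P \<in> U \<Longrightarrow> P \<in> Sp2 \<Longrightarrow> F P = f P"
    using smooth_Sp2_extension[OF assms(1) \<open>Q \<in> Sp2\<close>] by metis
  obtain V G where V: "Q \<in> V" "open V" "\<And>k. times_differentiable_on k V G"
    "\<And>P. P \<in> V \<Longrightarrow> P \<in> Sp2 \<Longrightarrow> G P = g P"
    using smooth_Sp2_extension[OF assms(2) \<open>Q \<in> Sp2\<close>] by metis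
  have "times_differentiable_on k (U \<inter> V) (\<lambda>P. F P + G P)" for k
    using U V by (intro times_differentiable_on_add open_Int)
      (auto intro: times_differentiable_on_subset)
  then show "\<exists>U F. Q \<in> U \<and> open U \<and> (\<forall>k. times_differentiable_on k U F) \<and> (\<forall>P\<in>U \<inter> Sp2. F P = f P + g P)"
    using U V by (intro exI[of _ "U \<inter> V"] exI[of _ "\<lambda>P. F P + G P"]) auto
qed

lemma has_derivative_tderiv:
  assumes "smooth_Sp2 f" "Q \<in> Sp2"
  obtains f' where "(f has_derivative f') (at Q within Sp2)" "\<And>v. v \<in> T_Sp2 Q \<Longrightarrow> tderiv f Q v = f' v"
  using smooth_Sp2_extension[OF assms] assms(2) by metis

context
  fixes Q v
  assumes Q: "Q \<in> Sp2" and v: "v \<in> T_Sp2 Q"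
begin

text \<open>Values away from \<open>Sp2\<close> do not matter. This is needed because vector fields are total functions and
identities between them hold on \<open>Sp2\<close> only.\<close>

lemma tderiv_cong: 
  assumes "\<And>P. P \<in> Sp2 \<Longrightarrow> f P = g P"
  shows "tderiv f Q v = tderiv g Q v"
proof -
  have "(f has_derivative f') (at Q within Sp2) \<longleftrightarrow> (g has_derivative f') (at Q within Sp2)" for f'
    using has_derivative_transform[OF Q, of g f f'] has_derivative_transform[OF Q, of f g f'] assms
    by auto
  then show ?thesis by (simp add: tderiv_def)
qed

lemma tderiv_const: "tderiv (\<lambda>P. c) Q v = 0"
  by (rule tderiv_eq[OF _ Q v]) simp

lemma tderiv_ident: "tderiv (\<lambda>P. P) Q v = v"
  by (rule tderiv_eq[OF _ Q v]) simp

lemma tderiv_linear: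
  assumes "bounded_linear h" "smooth_Sp2 f"
  shows "tderiv (\<lambda>P. h (f P)) Q v = h (tderiv f Q v)"
proof -
  obtain f' where "(f has_derivative f') (at Q within Sp2)" "tderiv f Q v = f' v"
    using has_derivative_tderiv[OF assms(2) Q] v by metis
  then show ?thesis
    using tderiv_eq[OF bounded_linear.has_derivative[OF assms(1)] Q v] by simp
qed

lemma tderiv_add:
  assumes "smooth_Sp2 f" "smooth_Sp2 g"
  shows "tderiv (\<lambda>P. f P + g P) Q v = tderiv f Q v + tderiv g Q v"
proof -
  obtain f' where "(f has_derivative f') (at Q within Sp2)" "tderiv f Q v = f' v"
    using has_derivative_tderiv[OF assms(1) Q] v by metis
  moreover obtain g' where "(g has_derivative g') (at Q within Sp2)" "tderiv g Q v = g' v"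
    using has_derivative_tderiv[OF assms(2) Q] v by metis
  ultimately show ?thesis
    using tderiv_eq[OF has_derivative_add Q v] by metis
qed

lemma tderiv_bilinear:
  assumes "bounded_bilinear h" "smooth_Sp2 f" "smooth_Sp2 g"
  shows "tderiv (\<lambda>P. h (f P) (g P)) Q v = h (f Q) (tderiv g Q v) + h (tderiv f Q v) (g Q)"
proof -
  obtain f' where "(f has_derivative f') (at Q within Sp2)" "tderiv f Q v = f' v"
    using has_derivative_tderiv[OF assms(2) Q] v by metis
  moreover obtain g' where "(g has_derivative g') (at Q within Sp2)" "tderiv g Q v = g' v"
    using has_derivative_tderiv[OF assms(3) Q] v by metis
  ultimately show ?thesis
    using tderiv_eq[OF bounded_bilinear.FDERIV[OF assms(1)] Q v] by metis
qed

end

lemma tderiv_direction_linear: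
  assumes "smooth_Sp2 f" "Q \<in> Sp2" "v \<in> T_Sp2 Q" "w \<in> T_Sp2 Q"
  shows "tderiv f Q (v + w) = tderiv f Q v + tderiv f Q w"
    "tderiv f Q (v - w) = tderiv f Q v - tderiv f Q w"
    "tderiv f Q (a *\<^sub>R v) = a *\<^sub>R tderiv f Q v"
proof -
  obtain f' where "(f has_derivative f') (at Q within Sp2)" "\<And>v. v \<in> T_Sp2 Q \<Longrightarrow> tderiv f Q v = f' v"
    using has_derivative_tderiv[OF assms(1,2)] by metis
  then show "tderiv f Q (v + w) = tderiv f Q v + tderiv f Q w"
    "tderiv f Q (v - w) = tderiv f Q v - tderiv f Q w"
    "tderiv f Q (a *\<^sub>R v) = a *\<^sub>R tderiv f Q v"
    using assms(3,4) subspace_T_Sp2[of Q] has_derivative_linear[of f f']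
    by (simp_all add: subspace_add subspace_diff subspace_scale linear_add linear_diff linear_scale)
qed

lemma linear_eq_sum_Basis:
  fixes f :: "'a::euclidean_space \<Rightarrow> 'b::real_vector"
  assumes "linear f"
  shows "f v = (\<Sum>b\<in>Basis. (v \<bullet> b) *\<^sub>R f b)"
  using linear_sum[OF assms, of "\<lambda>b. (v \<bullet> b) *\<^sub>R b" Basis] linear_scale[OF assms]
  by (simp add: euclidean_representation)

text \<open>Locally, \<open>tderiv f P (Y P)\<close> is the sum over the basis vectors \<open>b\<close> of the component \<open>G P \<bullet> b\<close> of an
extension \<open>G\<close> of \<open>Y\<close> times the partial derivative of an extension \<open>F\<close> of \<open>f\<close>.\<close>

lemma smooth_Sp2_tderiv:
  assumes "smooth_Sp2 f" "vfield Y"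
  shows "smooth_Sp2 (\<lambda>P. tderiv f P (Y P))"
proof (rule smooth_Sp2I)
  fix Q assume "Q \<in> Sp2"
  obtain U F where U: "Q \<in> U" "open U" "\<And>k. times_differentiable_on k U F"
    "\<And>P v. P \<in> U \<Longrightarrow> P \<in> Sp2 \<Longrightarrow> v \<in> T_Sp2 P \<Longrightarrow> tderiv f P v = frechet_derivative F (at P) v"
    using smooth_Sp2_extension[OF assms(1) \<open>Q \<in> Sp2\<close>] by metis
  have "smooth_Sp2 Y" using assms(2) by (simp add: vfield_def)
  from smooth_Sp2_extension[OF this \<open>Q \<in> Sp2\<close>]
  obtain V G where V: "Q \<in> V" "open V" "\<And>k. times_differentiable_on k V G"
    "\<And>P. P \<in> V \<Longrightarrow> P \<in> Sp2 \<Longrightarrow> G P = Y P"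
    by metis
  define H where "H P = (\<Sum>b\<in>Basis. (G P \<bullet> b) *\<^sub>R frechet_derivative F (at P) b)" for P
  have "times_differentiable_on k (U \<inter> V) H" for k
    unfolding H_def
  proof (intro times_differentiable_on_sum times_differentiable_on_bilinear[OF bounded_bilinear_scaleR]
      times_differentiable_on_linear[OF bounded_linear_inner_left] open_Int U V)
    show "times_differentiable_on k (U \<inter> V) G"
      using V(3) by (rule times_differentiable_on_subset) auto
    show "times_differentiable_on k (U \<inter> V) (\<lambda>P. frechet_derivative F (at P) b)" for b
      using U(3)[of "Suc k"] by (auto intro: times_differentiable_on_subset)
  qed
  moreover have "H P = tderiv f P (Y P)" if "P \<in> U \<inter> V" "P \<in> Sp2" for P
  proof -
    have "linear (frechet_derivative F (at P))"
      using U(3)[of 1] that by (simp add: linear_frechet_derivative)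
    then have "H P = frechet_derivative F (at P) (G P)"
      unfolding H_def by (simp add: linear_eq_sum_Basis[of _ "G P"])
    then show ?thesis
      using that U(4) V(4) assms(2) by (simp add: vfield_def)
  qed
  ultimately show "\<exists>U F. Q \<in> U \<and> open U \<and> (\<forall>k. times_differentiable_on k U F) \<and> (\<forall>P\<in>U \<inter> Sp2. F P = tderiv f P (Y P))"
    using U V by (intro exI[of _ "U \<inter> V"] exI[of _ H]) auto
qed

section \<open>Commutators of vector fields\<close>

text \<open>The product rule for \<open>P \<mapsto> F'(P)(Y P)\<close>, written with partial derivatives: one term contains the second
derivative of the extension \<open>F\<close>, the other one the derivative of \<open>Y\<close>.\<close>

lemma tderiv_tderiv:
  assumes "open U" "Q \<in> U" "Q \<in> Sp2" "\<And>k. times_differentiable_on k U F"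
    and tF: "\<And>P v. P \<in> U \<Longrightarrow> P \<in> Sp2 \<Longrightarrow> v \<in> T_Sp2 P \<Longrightarrow> tderiv f P v = frechet_derivative F (at P) v"
    and Y: "vfield Y" and v: "v \<in> T_Sp2 Q"
  shows "tderiv (\<lambda>P. tderiv f P (Y P)) Q v
    = (\<Sum>b\<in>Basis. (Y Q \<bullet> b) *\<^sub>R frechet_derivative (\<lambda>P. frechet_derivative F (at P) b) (at Q) v)
      + frechet_derivative F (at Q) (tderiv Y Q v)"
proof -
  let ?F = "\<lambda>b P. frechet_derivative F (at P) b"
  have lin: "linear (frechet_derivative F (at P))" if "P \<in> U" for P
    using assms(4)[of 1] that by (simp add: linear_frechet_derivative)
  obtain Y' where Y': "(Y has_derivative Y') (at Q within Sp2)" "tderiv Y Q v = Y' v"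
    using has_derivative_tderiv[of Y Q] Y assms(3) v unfolding vfield_def by metis
  have F': "(?F b has_derivative frechet_derivative (?F b) (at Q)) (at Q within Sp2)" for b
    using assms(4)[of 2] assms(2)
    by (auto simp: numeral_2_eq_2 frechet_derivative_works has_derivative_at_withinI)
  have "((\<lambda>P. \<Sum>b\<in>Basis. (Y P \<bullet> b) *\<^sub>R ?F b P) has_derivative
      (\<lambda>v. \<Sum>b\<in>Basis. (Y Q \<bullet> b) *\<^sub>R frechet_derivative (?F b) (at Q) v + (Y' v \<bullet> b) *\<^sub>R ?F b Q))
      (at Q within Sp2)"
    by (intro has_derivative_sum has_derivative_scaleR has_derivative_inner_left Y' F')
  moreover have eq: "(\<Sum>b\<in>Basis. (Y P \<bullet> b) *\<^sub>R ?F b P) = tderiv f P (Y P)" if "P \<in> U" "P \<in> Sp2" for P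
    using tF[OF that] Y that linear_eq_sum_Basis[OF lin[OF that(1)], of "Y P"]
    by (simp add: vfield_def)
  have "\<forall>\<^sub>F P in at Q within Sp2. (\<Sum>b\<in>Basis. (Y P \<bullet> b) *\<^sub>R ?F b P) = tderiv f P (Y P)"
    using eventually_nhds_in_open[OF assms(1,2)] eq
    by (auto simp: eventually_at_filter elim: eventually_mono)
  moreover have "(\<Sum>b\<in>Basis. (Y Q \<bullet> b) *\<^sub>R ?F b Q) = tderiv f Q (Y Q)"
    by (rule eq[OF assms(2,3)])
  ultimately have "((\<lambda>P. tderiv f P (Y P)) has_derivative
      (\<lambda>v. \<Sum>b\<in>Basis. (Y Q \<bullet> b) *\<^sub>R frechet_derivative (?F b) (at Q) v + (Y' v \<bullet> b) *\<^sub>R ?F b Q))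
      (at Q within Sp2)"
    by (rule has_derivative_transform_eventually) (rule assms(3))
  from tderiv_eq[OF this assms(3) v] show ?thesis
    using linear_eq_sum_Basis[OF lin[OF assms(2)], of "Y' v"]
    by (simp add: Y'(2) sum.distrib)
qed

text \<open>Lie brackets act as commutators of derivations. The second derivatives of an extension of \<open>f\<close>
cancel by symmetry, and the derivatives of the two fields combine to the bracket.\<close>

lemma tderiv_commutator:
  fixes f :: "qmat \<Rightarrow> 'b::real_inner"
  assumes f: "smooth_Sp2 f" and X: "vfield X" and Y: "vfield Y" and Q: "Q \<in> Sp2"
    and "lie_bracket X Y Q \<in> T_Sp2 Q"
  shows "tderiv (\<lambda>P. tderiv f P (Y P)) Q (X Q) - tderiv (\<lambda>P. tderiv f P (X P)) Q (Y Q)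
    = tderiv f Q (lie_bracket X Y Q)"
proof -
  obtain U F where U: "Q \<in> U" "open U" "\<And>k. times_differentiable_on k U F"
    "\<And>P v. P \<in> U \<Longrightarrow> P \<in> Sp2 \<Longrightarrow> v \<in> T_Sp2 P \<Longrightarrow> tderiv f P v = frechet_derivative F (at P) v"
    using smooth_Sp2_extension[OF f Q] by metis
  define D where "D b = frechet_derivative (\<lambda>P. frechet_derivative F (at P) b) (at Q)" for b
  have T: "X Q \<in> T_Sp2 Q" "Y Q \<in> T_Sp2 Q" using X Y Q by (auto simp: vfield_def)
  have lin: "linear (frechet_derivative F (at Q))"
    using U(3)[of 1] U(1) by (simp add: linear_frechet_derivative)
  have linD: "linear (D b)" for b
    using U(3)[of 2] U(1) by (simp add: D_def linear_frechet_derivative numeral_2_eq_2)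
  have sym: "D b c = D c b" for b c
    unfolding D_def by (rule second_derivative_symmetric[OF U(2,3,1)])
  have expand: "(\<Sum>b\<in>Basis. (u \<bullet> b) *\<^sub>R D b v) = (\<Sum>b\<in>Basis. \<Sum>c\<in>Basis. ((u \<bullet> b) * (v \<bullet> c)) *\<^sub>R D b c)" for u v
    by (subst linear_eq_sum_Basis[OF linD, of _ v]) (simp add: scaleR_sum_right)
  have "(\<Sum>b\<in>Basis. (Y Q \<bullet> b) *\<^sub>R D b (X Q)) = (\<Sum>b\<in>Basis. (X Q \<bullet> b) *\<^sub>R D b (Y Q))"
    unfolding expand by (subst sum.swap) (simp add: sym mult.commute)
  then have "tderiv (\<lambda>P. tderiv f P (Y P)) Q (X Q) - tderiv (\<lambda>P. tderiv f P (X P)) Q (Y Q)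
     = frechet_derivative F (at Q) (lie_bracket X Y Q)"
    using tderiv_tderiv[OF U(2,1) Q U(3,4) Y T(1)] tderiv_tderiv[OF U(2,1) Q U(3,4) X T(2)]
    by (simp add: D_def lie_bracket_def linear_diff[OF lin])
  then show ?thesis
    using U(4)[OF U(1) Q assms(5)] by simp
qed

section \<open>Left trivialisation\<close>

definition left_coord :: "(qmat \<Rightarrow> qmat) \<Rightarrow> qmat \<Rightarrow> qmat" where
  "left_coord X P = qadj P ** X P"

lemma smooth_Sp2_mult:
  fixes f g :: "qmat \<Rightarrow> qmat"
  assumes "smooth_Sp2 f" "smooth_Sp2 g"
  shows "smooth_Sp2 (\<lambda>P. f P ** g P)"
  by (rule smooth_Sp2_bilinear[OF bounded_bilinear_qmat_mult assms])

lemma smooth_left_coord: "smooth_Sp2 X \<Longrightarrow> smooth_Sp2 (left_coord X)"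
  unfolding left_coord_def[abs_def]
  by (intro smooth_Sp2_mult smooth_Sp2_linear[OF bounded_linear_qadj] smooth_Sp2_ident)

lemma vfield_mult:
  assumes "smooth_Sp2 f" "\<And>P. P \<in> Sp2 \<Longrightarrow> f P \<in> sp2_alg"
  shows "vfield (\<lambda>P. P ** f P)"
  unfolding vfield_def
  using assms by (auto intro: smooth_Sp2_mult smooth_Sp2_ident simp: T_Sp2_eq)

lemma vfield_left_invariant: "A \<in> sp2_alg \<Longrightarrow> vfield (\<lambda>P. P ** A)"
  by (rule vfield_mult[OF smooth_Sp2_const])

lemma vfield_left_coord:
  assumes "vfield X"
  shows "smooth_Sp2 (left_coord X)" "P \<in> Sp2 \<Longrightarrow> left_coord X P \<in> sp2_alg"
    "P \<in> Sp2 \<Longrightarrow> P ** left_coord X P = X P" "P \<in> Sp2 \<Longrightarrow> X P \<in> T_Sp2 P"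
  using assms by (auto simp: vfield_def smooth_left_coord mem_T_Sp2_iff left_coord_def Sp2_cancel_right)

text \<open>A derivative of a function with values in a linear subspace stays in it: apply the linear map
\<open>\<lambda>A. qadj A + A\<close> with kernel \<open>sp2_alg\<close>.\<close>

lemma tderiv_in_sp2_alg:
  assumes "smooth_Sp2 f" "\<And>P. P \<in> Sp2 \<Longrightarrow> f P \<in> sp2_alg" "Q \<in> Sp2" "v \<in> T_Sp2 Q"
  shows "tderiv f Q v \<in> sp2_alg"
proof -
  have "bounded_linear (\<lambda>A. qadj A + A)"
    by (intro bounded_linear_add bounded_linear_qadj bounded_linear_ident)
  from tderiv_linear[OF assms(3,4) this assms(1)]
  have "qadj (tderiv f Q v) + tderiv f Q v = tderiv (\<lambda>P. qadj (f P) + f P) Q v" ..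
  also have "\<dots> = tderiv (\<lambda>P. 0) Q v"
    using assms(2) by (intro tderiv_cong[OF assms(3,4)]) (simp add: sp2_alg_def)
  also have "\<dots> = 0" by (rule tderiv_const[OF assms(3,4)])
  finally show ?thesis by (simp add: sp2_alg_def eq_neg_iff_add_eq_0)
qed

lemma tderiv_vfield:
  assumes "vfield X" "Q \<in> Sp2" "v \<in> T_Sp2 Q"
  shows "tderiv X Q v = Q ** tderiv (left_coord X) Q v + v ** left_coord X Q"
proof -
  have "tderiv X Q v = tderiv (\<lambda>P. P ** left_coord X P) Q v"
    using vfield_left_coord(3)[OF assms(1)] by (intro tderiv_cong[OF assms(2,3)]) simp
  also have "\<dots> = Q ** tderiv (left_coord X) Q v + v ** left_coord X Q"
    using tderiv_bilinear[OF assms(2,3) bounded_bilinear_qmat_mult smooth_Sp2_ident vfield_left_coord(1)[OF assms(1)]]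
    by (simp add: tderiv_ident[OF assms(2,3)])
  finally show ?thesis .
qed

lemma left_coord_lie_bracket:
  assumes "vfield X" "vfield Y" "Q \<in> Sp2"
  shows "left_coord (lie_bracket X Y) Q
    = left_coord X Q ** left_coord Y Q - left_coord Y Q ** left_coord X Q
      + tderiv (left_coord Y) Q (X Q) - tderiv (left_coord X) Q (Y Q)"
proof -
  have T: "X Q \<in> T_Sp2 Q" "Y Q \<in> T_Sp2 Q"
    using vfield_left_coord(4) assms by auto
  have "qadj Q ** (Z Q ** A) = left_coord Z Q ** A" for Z and A :: qmat
    by (simp add: left_coord_def matrix_mul_assoc)
  moreover have "left_coord (lie_bracket X Y) Q = qadj Q ** (tderiv Y Q (X Q) - tderiv X Q (Y Q))"
    by (simp add: left_coord_def lie_bracket_def)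
  ultimately show ?thesis
    unfolding tderiv_vfield[OF assms(2,3) T(1)] tderiv_vfield[OF assms(1,3) T(2)]
    by (simp add: qmat_mult_simps Sp2_cancel_left[OF assms(3)])
qed

lemma lie_bracket_sp2_alg: "A \<in> sp2_alg \<Longrightarrow> B \<in> sp2_alg \<Longrightarrow> A ** B - B ** A \<in> sp2_alg"
  by (simp add: sp2_alg_def qadj_simps qadj_mult qmat_mult_simps)

lemma lie_bracket_tangent:
  assumes "vfield X" "vfield Y" "Q \<in> Sp2"
  shows "left_coord (lie_bracket X Y) Q \<in> sp2_alg" "lie_bracket X Y Q \<in> T_Sp2 Q"
proof -
  show "left_coord (lie_bracket X Y) Q \<in> sp2_alg"
    unfolding left_coord_lie_bracket[OF assms]
    using assms vfield_left_coord
    by (intro subspace_add subspace_diff subspace_sp2_alg lie_bracket_sp2_alg tderiv_in_sp2_alg) auto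
  then show "lie_bracket X Y Q \<in> T_Sp2 Q"
    by (simp add: mem_T_Sp2_iff assms(3) left_coord_def)
qed

section \<open>The Levi-Civita connection\<close>

definition inner_r :: "real \<Rightarrow> real \<Rightarrow> qmat \<Rightarrow> qmat \<Rightarrow> real" where
  "inner_r r1 r2 A B = r1 / 2 * ((A $ 1 $ 1) \<bullet> (B $ 1 $ 1)) + (A $ 1 $ 2) \<bullet> (B $ 1 $ 2)
      + r2 / 2 * ((A $ 2 $ 2) \<bullet> (B $ 2 $ 2))"

text \<open>The covariant derivative of one left invariant field along another. The Koszul formula gives half of
the commutator plus a symmetric correction, which lies in the off-diagonal entry and is
\<open>((1 - r1) (x1 y2 + x2 y1) - (1 - r2) (y2 z1 + y1 z2)) / 2\<close>; it vanishes for the bi-invariant metric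
\<open>r1 = r2 = 1\<close>.\<close>

definition LC_product :: "real \<Rightarrow> real \<Rightarrow> qmat \<Rightarrow> qmat \<Rightarrow> qmat" where
  "LC_product r1 r2 A B =
    (let x1 = A $ 1 $ 1; y1 = A $ 1 $ 2; z1 = A $ 2 $ 2;
         x2 = B $ 1 $ 1; y2 = B $ 1 $ 2; z2 = B $ 2 $ 2
     in (1 / 2) *\<^sub>R sp2_mat (x1 * x2 - x2 * x1 + y2 * qcnj y1 - y1 * qcnj y2)
      ((2 - r1) *\<^sub>R (x1 * y2) - r1 *\<^sub>R (x2 * y1) - (2 - r2) *\<^sub>R (y2 * z1) + r2 *\<^sub>R (y1 * z2))
      (z1 * z2 - z2 * z1 + qcnj y2 * y1 - qcnj y1 * y2))"

lemma bounded_bilinear_inner_r: "bounded_bilinear (inner_r r1 r2)"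
  unfolding bilinear_conv_bounded_bilinear[symmetric] bilinear_def
  by (auto intro!: linearI simp: inner_r_def algebra_simps inner_add_left inner_add_right add_divide_distrib)

lemma bounded_bilinear_LC_product: "bounded_bilinear (LC_product r1 r2)"
  unfolding bilinear_conv_bounded_bilinear[symmetric] bilinear_def
  by (auto intro!: linearI simp: LC_product_def Let_def qmat_eq_iff)
     (auto simp: quat_eq_iff algebra_simps)

lemma LC_product_in_alg: "LC_product r1 r2 A B \<in> sp2_alg"
  unfolding LC_product_def Let_def
  by (intro subspace_scale subspace_sp2_alg sp2_mat_in_alg) (auto simp: algebra_simps)

lemma sp2_mat_bracket:
  assumes "qRe x1 = 0" "qRe z1 = 0" "qRe x2 = 0" "qRe z2 = 0"
  shows "sp2_mat x1 y1 z1 ** sp2_mat x2 y2 z2 - sp2_mat x2 y2 z2 ** sp2_mat x1 y1 z1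
    = sp2_mat (x1 * x2 - x2 * x1 + y2 * qcnj y1 - y1 * qcnj y2)
        (x1 * y2 - x2 * y1 - y2 * z1 + y1 * z2)
        (z1 * z2 - z2 * z1 + qcnj y2 * y1 - qcnj y1 * y2)"
  using assms
  by (simp add: qmat_eq_iff matrix_matrix_mult_def sum_2) (simp add: quat_eq_iff)

lemma LC_product_torsion_free:
  assumes "A \<in> sp2_alg" "B \<in> sp2_alg"
  shows "LC_product r1 r2 A B - LC_product r1 r2 B A = A ** B - B ** A"
proof -
  obtain x1 y1 z1 where A: "A = sp2_mat x1 y1 z1" "qRe x1 = 0" "qRe z1 = 0" using assms(1) by (rule sp2_algE)
  obtain x2 y2 z2 where B: "B = sp2_mat x2 y2 z2" "qRe x2 = 0" "qRe z2 = 0" using assms(2) by (rule sp2_algE)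
  show ?thesis
    unfolding A(1) B(1) sp2_mat_bracket[OF A(2,3) B(2,3)]
    by (simp add: LC_product_def qmat_eq_iff) (simp add: quat_eq_iff algebra_simps)
qed

text \<open>Left invariant fields have constant inner products, so metric compatibility of the connection says
that \<open>LC_product r1 r2 A\<close> is skew-adjoint.\<close>

lemma LC_product_metric:
  assumes "A \<in> sp2_alg" "B \<in> sp2_alg" "C \<in> sp2_alg"
  shows "inner_r r1 r2 (LC_product r1 r2 A B) C + inner_r r1 r2 B (LC_product r1 r2 A C) = 0"
proof -
  obtain x1 y1 z1 where A: "A = sp2_mat x1 y1 z1" "qRe x1 = 0" "qRe z1 = 0" using assms(1) by (rule sp2_algE)
  obtain x2 y2 z2 where B: "B = sp2_mat x2 y2 z2" "qRe x2 = 0" "qRe z2 = 0" using assms(2) by (rule sp2_algE)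
  obtain x3 y3 z3 where C: "C = sp2_mat x3 y3 z3" "qRe x3 = 0" "qRe z3 = 0" using assms(3) by (rule sp2_algE)
  show ?thesis
    unfolding A(1) B(1) C(1)
    by (simp add: LC_product_def inner_r_def inner_quat_def A B C algebra_simps)
qed

lemma inner_r_eq_0:
  assumes "r1 > 0" "r2 > 0" "A \<in> sp2_alg" "inner_r r1 r2 A A = 0"
  shows "A = 0"
proof -
  obtain x y z where A: "A = sp2_mat x y z" using assms(3) by (rule sp2_algE)
  have "r1 / 2 * (x \<bullet> x) + y \<bullet> y + r2 / 2 * (z \<bullet> z) = 0"
    using assms(4) by (simp add: A inner_r_def)
  moreover have "r1 / 2 * (x \<bullet> x) \<ge> 0" "y \<bullet> y \<ge> 0" "r2 / 2 * (z \<bullet> z) \<ge> 0"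
    using assms by auto
  ultimately have "r1 / 2 * (x \<bullet> x) = 0" "y \<bullet> y = 0" "r2 / 2 * (z \<bullet> z) = 0"
    by linarith+
  then have "x = 0" "y = 0" "z = 0"
    using assms(1,2) by auto
  then show ?thesis by (simp add: A qmat_eq_iff quat_eq_iff)
qed

lemma g_r_eq: "g_r r1 r2 P U V = inner_r r1 r2 (qadj P ** U) (qadj P ** V)"
  by (simp add: g_r_def inner_r_def Let_def)

definition nabla :: "real \<Rightarrow> real \<Rightarrow> connection" where
  "nabla r1 r2 X Y P = P ** (tderiv (left_coord Y) P (X P) + LC_product r1 r2 (left_coord X P) (left_coord Y P))"

lemma left_coord_nabla:
  assumes "Q \<in> Sp2"
  shows "left_coord (nabla r1 r2 X Y) Q = tderiv (left_coord Y) Q (X Q) + LC_product r1 r2 (left_coord X Q) (left_coord Y Q)"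
  by (simp add: left_coord_def[of "nabla r1 r2 X Y"] nabla_def Sp2_cancel_left[OF assms])

lemma vfield_nabla:
  assumes "vfield X" "vfield Y"
  shows "vfield (nabla r1 r2 X Y)"
  unfolding nabla_def[abs_def]
proof (rule vfield_mult)
  show "smooth_Sp2 (\<lambda>P. tderiv (left_coord Y) P (X P) + LC_product r1 r2 (left_coord X P) (left_coord Y P))"
    by (intro smooth_Sp2_add smooth_Sp2_tderiv smooth_Sp2_bilinear[OF bounded_bilinear_LC_product]
        vfield_left_coord assms)
  show "tderiv (left_coord Y) P (X P) + LC_product r1 r2 (left_coord X P) (left_coord Y P) \<in> sp2_alg"
    if "P \<in> Sp2" for P
    using that assms by (intro subspace_add subspace_sp2_alg LC_product_in_alg tderiv_in_sp2_alg) (auto simp: vfield_left_coord)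
qed

lemma left_coord_add: "left_coord (\<lambda>P. X P + Y P) P = left_coord X P + left_coord Y P"
  by (simp add: left_coord_def qmat_mult_simps)

lemma left_coord_scaleR: "left_coord (\<lambda>P. f P *\<^sub>R X P) P = f P *\<^sub>R left_coord X P"
  by (simp add: left_coord_def qmat_mult_simps)

lemmas LC_product_simps =
  bounded_bilinear.add_left[OF bounded_bilinear_LC_product]
  bounded_bilinear.add_right[OF bounded_bilinear_LC_product]
  bounded_bilinear.diff_left[OF bounded_bilinear_LC_product]
  bounded_bilinear.diff_right[OF bounded_bilinear_LC_product]
  bounded_bilinear.scaleR_left[OF bounded_bilinear_LC_product]
  bounded_bilinear.scaleR_right[OF bounded_bilinear_LC_product]

lemmas inner_r_simps =
  bounded_bilinear.add_left[OF bounded_bilinear_inner_r]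
  bounded_bilinear.add_right[OF bounded_bilinear_inner_r]
  bounded_bilinear.diff_left[OF bounded_bilinear_inner_r]
  bounded_bilinear.diff_right[OF bounded_bilinear_inner_r]

lemma affine_connection_nabla: "affine_connection (nabla r1 r2)"
  unfolding affine_connection_def
proof (intro conjI allI impI ballI)
  fix X Y assume "vfield X" "vfield Y"
  then show "vfield (nabla r1 r2 X Y)" by (rule vfield_nabla)
next
  fix X X' Y Q assume "vfield X" "vfield X'" "vfield Y" "Q \<in> Sp2"
  then show "nabla r1 r2 (\<lambda>P. X P + X' P) Y Q = nabla r1 r2 X Y Q + nabla r1 r2 X' Y Q"
    using tderiv_direction_linear(1)[of "left_coord Y" Q "X Q" "X' Q"] vfield_left_coord
    by (simp add: nabla_def left_coord_add LC_product_simps qmat_mult_simps)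
next
  fix X Y Y' Q assume *: "vfield X" "vfield Y" "vfield Y'" "Q \<in> Sp2"
  have "left_coord (\<lambda>P. Y P + Y' P) = (\<lambda>P. left_coord Y P + left_coord Y' P)"
    by (simp add: left_coord_add fun_eq_iff)
  then show "nabla r1 r2 X (\<lambda>P. Y P + Y' P) Q = nabla r1 r2 X Y Q + nabla r1 r2 X Y' Q"
    using * tderiv_add[of Q "X Q" "left_coord Y" "left_coord Y'"] vfield_left_coord
    by (simp add: nabla_def LC_product_simps qmat_mult_simps)
next
  fix f :: "qmat \<Rightarrow> real" and X Y Q assume "smooth_Sp2 f" "vfield X" "vfield Y" "Q \<in> Sp2"
  then show "nabla r1 r2 (\<lambda>P. f P *\<^sub>R X P) Y Q = f Q *\<^sub>R nabla r1 r2 X Y Q"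
    using tderiv_direction_linear(3)[of "left_coord Y" Q "X Q" "X Q" "f Q"] vfield_left_coord
    by (simp add: nabla_def left_coord_scaleR LC_product_simps qmat_mult_simps scaleR_add_right)
next
  fix f :: "qmat \<Rightarrow> real" and X Y Q assume *: "smooth_Sp2 f" "vfield X" "vfield Y" "Q \<in> Sp2"
  have "left_coord (\<lambda>P. f P *\<^sub>R Y P) = (\<lambda>P. f P *\<^sub>R left_coord Y P)"
    by (simp add: left_coord_scaleR fun_eq_iff)
  then show "nabla r1 r2 X (\<lambda>P. f P *\<^sub>R Y P) Q = tderiv f Q (X Q) *\<^sub>R Y Q + f Q *\<^sub>R nabla r1 r2 X Y Q"
    using * tderiv_bilinear[of Q "X Q" "(*\<^sub>R)" f "left_coord Y"] vfield_left_coord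
    by (simp add: nabla_def LC_product_simps qmat_mult_simps scaleR_add_right bounded_bilinear_scaleR)
qed

lemma levi_civita_nabla: "levi_civita (g_r r1 r2) (nabla r1 r2)"
  unfolding levi_civita_def
proof (intro conjI affine_connection_nabla allI impI ballI)
  fix X Y Q assume *: "vfield X" "vfield Y" "Q \<in> Sp2"
  have "nabla r1 r2 X Y Q - nabla r1 r2 Y X Q = Q ** left_coord (lie_bracket X Y) Q"
    unfolding left_coord_lie_bracket[OF *]
    using LC_product_torsion_free[of "left_coord X Q" "left_coord Y Q" r1 r2] vfield_left_coord *
    unfolding nabla_def bounded_bilinear.diff_right[OF bounded_bilinear_qmat_mult, symmetric]
    by (intro arg_cong[where f = "\<lambda>A. Q ** A"]) (simp add: algebra_simps)
  also have "\<dots> = lie_bracket X Y Q"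
    by (simp add: left_coord_def Sp2_cancel_right[OF *(3)])
  finally show "nabla r1 r2 X Y Q - nabla r1 r2 Y X Q = lie_bracket X Y Q" .
next
  fix X Y Z Q assume *: "vfield X" "vfield Y" "vfield Z" "Q \<in> Sp2"
  let ?x = "left_coord X Q" and ?y = "left_coord Y Q" and ?z = "left_coord Z Q"
  have "tderiv (\<lambda>P. g_r r1 r2 P (Y P) (Z P)) Q (X Q)
      = tderiv (\<lambda>P. inner_r r1 r2 (left_coord Y P) (left_coord Z P)) Q (X Q)"
    by (simp add: g_r_eq left_coord_def)
  also have "\<dots> = inner_r r1 r2 ?y (tderiv (left_coord Z) Q (X Q)) + inner_r r1 r2 (tderiv (left_coord Y) Q (X Q)) ?z"
    using * vfield_left_coord by (intro tderiv_bilinear[OF _ _ bounded_bilinear_inner_r]) auto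
  also have "\<dots> = inner_r r1 r2 (left_coord (nabla r1 r2 X Y) Q) ?z + inner_r r1 r2 ?y (left_coord (nabla r1 r2 X Z) Q)"
    using LC_product_metric[of ?x ?y ?z r1 r2] * vfield_left_coord
    by (simp add: left_coord_nabla inner_r_simps)
  finally show "tderiv (\<lambda>P. g_r r1 r2 P (Y P) (Z P)) Q (X Q)
      = g_r r1 r2 Q (nabla r1 r2 X Y Q) (Z Q) + g_r r1 r2 Q (Y Q) (nabla r1 r2 X Z Q)"
    by (simp add: g_r_eq left_coord_def)
qed

text \<open>Expand the three derivatives of inner products by metric compatibility and the three brackets by
vanishing torsion; everything except \<open>D X Y\<close> cancels.\<close>

lemma koszul_formula:
  assumes D: "levi_civita g D" and g: "\<And>Q. bilinear (g Q)" "\<And>Q U V. g Q U V = g Q V U"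
    and X: "vfield X" and Y: "vfield Y" and Z: "vfield Z" and Q: "Q \<in> Sp2"
  shows "2 * g Q (D X Y Q) (Z Q)
    = tderiv (\<lambda>P. g P (Y P) (Z P)) Q (X Q) + tderiv (\<lambda>P. g P (X P) (Z P)) Q (Y Q)
      - tderiv (\<lambda>P. g P (X P) (Y P)) Q (Z Q)
      + g Q (lie_bracket X Y Q) (Z Q) - g Q (lie_bracket X Z Q) (Y Q) - g Q (lie_bracket Y Z Q) (X Q)"
proof -
  have tor: "D X Y Q - D Y X Q = lie_bracket X Y Q" if "vfield X" "vfield Y" for X Y
    using D that Q unfolding levi_civita_def by blast
  have met: "tderiv (\<lambda>P. g P (Y P) (Z P)) Q (X Q) = g Q (D X Y Q) (Z Q) + g Q (Y Q) (D X Z Q)"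
    if "vfield X" "vfield Y" "vfield Z" for X Y Z
    using D that Q unfolding levi_civita_def by blast
  show ?thesis
    unfolding met[OF X Y Z] met[OF Y X Z] met[OF Z X Y]
      tor[OF X Y, symmetric] tor[OF X Z, symmetric] tor[OF Y Z, symmetric]
    using g(2)[of Q "X Q"] g(2)[of Q "Y Q"] by (simp add: bilinear_lsub[OF g(1)])
qed

text \<open>The right-hand side of the Koszul formula does not mention the connection. Testing it against the left
invariant field through the difference \<open>w\<close> of the two candidates shows that \<open>w\<close> has length zero.\<close>

lemma levi_civita_unique:
  assumes "r1 > 0" "r2 > 0" and D: "levi_civita (g_r r1 r2) D" "levi_civita (g_r r1 r2) D'"
    and X: "vfield X" and Y: "vfield Y" and Q: "Q \<in> Sp2"
  shows "D X Y Q = D' X Y Q"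
proof -
  have v: "vfield (D X Y)" "vfield (D' X Y)"
    using D X Y by (auto simp: levi_civita_def affine_connection_def)
  define w where "w = left_coord (D X Y) Q - left_coord (D' X Y) Q"
  have w: "w \<in> sp2_alg"
    unfolding w_def using v Q by (intro subspace_diff subspace_sp2_alg vfield_left_coord)
  have "g_r r1 r2 Q (D X Y Q) (Q ** w) = g_r r1 r2 Q (D' X Y Q) (Q ** w)"
    using koszul_formula[OF D(1) g_r_bilinear g_r_commute X Y vfield_left_invariant[OF w] Q]
      koszul_formula[OF D(2) g_r_bilinear g_r_commute X Y vfield_left_invariant[OF w] Q] by simp
  then have "inner_r r1 r2 w w = 0"
    unfolding g_r_eq Sp2_cancel_left[OF Q] by (simp add: w_def left_coord_def inner_r_simps)
  then have "w = 0" using inner_r_eq_0 assms(1,2) w by blast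
  then show ?thesis
    using vfield_left_coord(3)[OF v(1) Q] vfield_left_coord(3)[OF v(2) Q] by (simp add: w_def)
qed

section \<open>The curvature tensor\<close>

definition curv :: "real \<Rightarrow> real \<Rightarrow> qmat \<Rightarrow> qmat \<Rightarrow> qmat \<Rightarrow> qmat" where
  "curv r1 r2 A B C = LC_product r1 r2 A (LC_product r1 r2 B C) - LC_product r1 r2 B (LC_product r1 r2 A C)
    - LC_product r1 r2 (A ** B - B ** A) C"

lemma tderiv_left_coord_nabla:
  assumes "vfield X" "vfield Y" "vfield Z" "Q \<in> Sp2"
  shows "tderiv (left_coord (nabla r1 r2 Y Z)) Q (X Q)
    = tderiv (\<lambda>P. tderiv (left_coord Z) P (Y P)) Q (X Q)
      + LC_product r1 r2 (left_coord Y Q) (tderiv (left_coord Z) Q (X Q))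
      + LC_product r1 r2 (tderiv (left_coord Y) Q (X Q)) (left_coord Z Q)"
proof -
  have T: "X Q \<in> T_Sp2 Q" using assms by (simp add: vfield_left_coord)
  have "tderiv (left_coord (nabla r1 r2 Y Z)) Q (X Q)
    = tderiv (\<lambda>P. tderiv (left_coord Z) P (Y P) + LC_product r1 r2 (left_coord Y P) (left_coord Z P)) Q (X Q)"
    by (intro tderiv_cong[OF assms(4) T] left_coord_nabla)
  also have "\<dots> = tderiv (\<lambda>P. tderiv (left_coord Z) P (Y P)) Q (X Q)
      + tderiv (\<lambda>P. LC_product r1 r2 (left_coord Y P) (left_coord Z P)) Q (X Q)"
    using assms by (intro tderiv_add[OF assms(4) T] smooth_Sp2_tderiv smooth_Sp2_bilinear[OF bounded_bilinear_LC_product] vfield_left_coord)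
  also have "tderiv (\<lambda>P. LC_product r1 r2 (left_coord Y P) (left_coord Z P)) Q (X Q)
     = LC_product r1 r2 (left_coord Y Q) (tderiv (left_coord Z) Q (X Q))
      + LC_product r1 r2 (tderiv (left_coord Y) Q (X Q)) (left_coord Z Q)"
    using assms by (intro tderiv_bilinear[OF assms(4) T bounded_bilinear_LC_product] vfield_left_coord)
  finally show ?thesis by (simp add: add.assoc)
qed

text \<open>The derivatives \<open>d\<eta>(X)\<close> and \<open>d\<xi>(Y)\<close> cancel against those in the coordinates of the bracket, and the second
derivatives of the coordinates of \<open>Z\<close> cancel by the commutator formula. In particular the value depends
only on the three vectors at \<open>Q\<close>.\<close>

lemma curvature_nabla:
  assumes "vfield X" "vfield Y" "vfield Z" "Q \<in> Sp2"
  shows "curvature_op (nabla r1 r2) X Y Z Q = Q ** curv r1 r2 (left_coord X Q) (left_coord Y Q) (left_coord Z Q)"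
proof -
  have comm: "tderiv (\<lambda>P. tderiv (left_coord Z) P (Y P)) Q (X Q) - tderiv (\<lambda>P. tderiv (left_coord Z) P (X P)) Q (Y Q)
    = tderiv (left_coord Z) Q (lie_bracket X Y Q)"
    by (intro tderiv_commutator lie_bracket_tangent vfield_left_coord assms)
  have "curvature_op (nabla r1 r2) X Y Z Q
    = Q ** (tderiv (left_coord (nabla r1 r2 Y Z)) Q (X Q) + LC_product r1 r2 (left_coord X Q) (left_coord (nabla r1 r2 Y Z) Q)
       - (tderiv (left_coord (nabla r1 r2 X Z)) Q (Y Q) + LC_product r1 r2 (left_coord Y Q) (left_coord (nabla r1 r2 X Z) Q))
       - (tderiv (left_coord Z) Q (lie_bracket X Y Q) + LC_product r1 r2 (left_coord (lie_bracket X Y) Q) (left_coord Z Q)))"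
    unfolding curvature_op_def by (simp only: nabla_def[of r1 r2 X "nabla r1 r2 Y Z"]
        nabla_def[of r1 r2 Y "nabla r1 r2 X Z"] nabla_def[of r1 r2 "lie_bracket X Y"] qmat_mult_simps)
  also have "\<dots> = Q ** curv r1 r2 (left_coord X Q) (left_coord Y Q) (left_coord Z Q)"
    unfolding left_coord_nabla[OF assms(4)] tderiv_left_coord_nabla[OF assms]
      tderiv_left_coord_nabla[OF assms(2,1,3,4)] left_coord_lie_bracket[OF assms(1,2,4)] comm[symmetric]
    by (rule arg_cong[where f = "\<lambda>A. Q ** A"]) (simp add: curv_def LC_product_simps)
  finally show ?thesis .
qed

text \<open>An arbitrary Levi-Civita connection agrees with \<open>nabla\<close> at the points of \<open>Sp2\<close> only, so the inner fields
\<open>D Y Z\<close> and \<open>nabla r1 r2 Y Z\<close> may be different functions. The outer derivative does not see the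
difference, since \<open>nabla\<close> is built from \<open>tderiv\<close>.\<close>

lemma curvature_op_levi_civita:
  assumes "r1 > 0" "r2 > 0" "levi_civita (g_r r1 r2) D" "vfield X" "vfield Y" "vfield Z" "Q \<in> Sp2"
  shows "curvature_op D X Y Z Q = curvature_op (nabla r1 r2) X Y Z Q"
proof -
  have eq: "D X Y P = nabla r1 r2 X Y P" if "vfield X" "vfield Y" "P \<in> Sp2" for X Y P
    using levi_civita_unique[OF assms(1-3) levi_civita_nabla] that .
  have v: "vfield (D X Y)" if "vfield X" "vfield Y" for X Y
    using assms(3) that by (auto simp: levi_civita_def affine_connection_def)
  have eq2: "D X (D Y Z) Q = nabla r1 r2 X (nabla r1 r2 Y Z) Q" if "vfield X" "vfield Y" "vfield Z" for X Y Z
  proof -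
    have T: "X Q \<in> T_Sp2 Q" using that(1) assms(7) by (simp add: vfield_left_coord)
    have "left_coord (D Y Z) P = left_coord (nabla r1 r2 Y Z) P" if "P \<in> Sp2" for P
      using eq[OF \<open>vfield Y\<close> \<open>vfield Z\<close> that] by (simp add: left_coord_def)
    then show ?thesis
      unfolding eq[OF that(1) v[OF that(2,3)] assms(7)]
        nabla_def[of r1 r2 X "D Y Z"] nabla_def[of r1 r2 X "nabla r1 r2 Y Z"]
      using tderiv_cong[OF assms(7) T, of "left_coord (D Y Z)" "left_coord (nabla r1 r2 Y Z)"] assms(7)
      by simp
  qed
  have "smooth_Sp2 (D X Y)" "smooth_Sp2 (D Y X)"
    using v[OF assms(4,5)] v[OF assms(5,4)] by (simp_all add: vfield_def)
  from smooth_Sp2_add[OF this(1) smooth_Sp2_linear[OF bounded_linear_minus[OF bounded_linear_ident] this(2)]]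
  have "vfield (\<lambda>P. D X Y P - D Y X P)"
    using v[OF assms(4,5)] v[OF assms(5,4)]
    by (simp add: vfield_def subspace_diff subspace_T_Sp2)
  moreover have "D X Y P - D Y X P = lie_bracket X Y P" if "P \<in> Sp2" for P
    using assms(3-5) that by (simp add: levi_civita_def)
  ultimately have "vfield (lie_bracket X Y)"
    unfolding vfield_def by (auto intro: smooth_Sp2_cong)
  then show ?thesis
    using eq eq2 assms(4-7) by (simp add: curvature_op_def)
qed

theorem riemann_eq:
  assumes "r1 > 0" "r2 > 0" "Q \<in> Sp2" "A \<in> sp2_alg" "B \<in> sp2_alg" "C \<in> sp2_alg"
  shows "riemann (g_r r1 r2) Q (Q ** A) (Q ** B) (Q ** C) = Q ** curv r1 r2 A B C"
  unfolding riemann_def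
proof (rule the_equality)
  have "left_coord (\<lambda>P. P ** A) Q = A" for A
    by (simp add: left_coord_def Sp2_cancel_left[OF assms(3)])
  then show "\<exists>D X Y Z. levi_civita (g_r r1 r2) D \<and> vfield X \<and> vfield Y \<and> vfield Z \<and>
      X Q = Q ** A \<and> Y Q = Q ** B \<and> Z Q = Q ** C \<and> Q ** curv r1 r2 A B C = curvature_op D X Y Z Q"
    using curvature_nabla[OF vfield_left_invariant vfield_left_invariant vfield_left_invariant assms(3), OF assms(4-6)]
    by (intro exI[of _ "nabla r1 r2"] exI[of _ "\<lambda>P. P ** A"] exI[of _ "\<lambda>P. P ** B"] exI[of _ "\<lambda>P. P ** C"])
       (simp add: levi_civita_nabla vfield_left_invariant assms)
next
  fix a assume "\<exists>D X Y Z. levi_civita (g_r r1 r2) D \<and> vfield X \<and> vfield Y \<and> vfield Z \<and>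
      X Q = Q ** A \<and> Y Q = Q ** B \<and> Z Q = Q ** C \<and> a = curvature_op D X Y Z Q"
  then obtain D X Y Z where *: "levi_civita (g_r r1 r2) D" "vfield X" "vfield Y" "vfield Z"
      "X Q = Q ** A" "Y Q = Q ** B" "Z Q = Q ** C" "a = curvature_op D X Y Z Q" by blast
  have "left_coord X Q = A" "left_coord Y Q = B" "left_coord Z Q = C"
    using * by (simp_all add: left_coord_def Sp2_cancel_left[OF assms(3)])
  then show "a = Q ** curv r1 r2 A B C"
    using curvature_op_levi_civita[OF assms(1,2) *(1-4) assms(3)] curvature_nabla[OF *(2-4) assms(3)] *(8) by simp
qed

lemma riemann_inner:
  assumes "r1 > 0" "r2 > 0" "Q \<in> Sp2" "A \<in> sp2_alg" "B \<in> sp2_alg" "C \<in> sp2_alg"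
  shows "g_r r1 r2 Q (riemann (g_r r1 r2) Q (Q ** A) (Q ** B) (Q ** C)) (Q ** D) = inner_r r1 r2 (curv r1 r2 A B C) D"
  by (simp only: riemann_eq[OF assms] g_r_eq Sp2_cancel_left[OF assms(3)])


section \<open>Sectional curvature\<close>

text \<open>Skew-adjointness moves one factor to the other side, which turns the two iterated products into inner
products of simple ones.\<close>

lemma inner_curv:
  assumes "A \<in> sp2_alg" "B \<in> sp2_alg"
  shows "inner_r r1 r2 (curv r1 r2 A B C) A
    = inner_r r1 r2 (LC_product r1 r2 A C) (LC_product r1 r2 B A)
      - inner_r r1 r2 (LC_product r1 r2 B C) (LC_product r1 r2 A A)
      - inner_r r1 r2 (LC_product r1 r2 (A ** B - B ** A) C) A"
  using LC_product_metric[OF assms(1) LC_product_in_alg assms(1), of r1 r2 r1 r2 B C]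
    LC_product_metric[OF assms(2) LC_product_in_alg assms(1), of r1 r2 r1 r2 A C]
  by (simp add: curv_def inner_r_simps)

lemma inner_commutator_quat:
  fixes x y w :: quat
  assumes "qRe x = 0" "qRe y = 0"
  shows "(w * y - y * w) \<bullet> x = - (w \<bullet> (x * y - y * x))"
  using assms by (simp add: inner_quat_def algebra_simps)

lemma inner_imaginary_left_quat:
  fixes x v y :: quat
  assumes "qRe x = 0"
  shows "(x * v) \<bullet> y = - (v \<bullet> (x * y))" "(v * x) \<bullet> y = - (v \<bullet> (y * x))"
  using assms by (simp_all add: inner_quat_def algebra_simps)

lemma inner_imaginary_part_quat:
  fixes x v y :: quat
  assumes "qRe x = 0"
  shows "(y * qcnj v - v * qcnj y) \<bullet> x = - 2 * (v \<bullet> (x * y))"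
    "(qcnj y * v - qcnj v * y) \<bullet> x = 2 * (v \<bullet> (y * x))"
  using assms by (simp_all add: inner_quat_def algebra_simps)

lemma inner_imaginary_mult_quat:
  fixes w y1 y2 :: quat
  assumes "qRe w = 0"
  shows "(w * y2) \<bullet> y1 = - (1 / 2) * (w \<bullet> (y2 * qcnj y1 - y1 * qcnj y2))"
    "(y2 * w) \<bullet> y1 = (1 / 2) * (w \<bullet> (qcnj y2 * y1 - qcnj y1 * y2))"
  using assms by (simp_all add: inner_quat_def algebra_simps)

text \<open>These identities reduce the products \<open>x1 y1\<close>, \<open>x2 y2\<close>, \<open>y1 z1\<close>, \<open>y2 z2\<close>, which enter the curvature through
\<open>LC_product A A\<close> and \<open>LC_product B B\<close>, to the four products that occur in the bracket of \<open>A\<close> and \<open>B\<close>. The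
third one has no correction term like those of the first two; this is why only
\<open>|r1 \<alpha> - r2 \<beta>|\<^sup>2\<close> couples the two diagonal entries in the final formula.\<close>

lemma inner_exchange_quat:
  fixes x1 x2 y1 y2 z1 z2 :: quat
  assumes "qRe x1 = 0" "qRe x2 = 0" "qRe z1 = 0" "qRe z2 = 0"
  shows "(x1 * y1) \<bullet> (x2 * y2)
      = (x1 * y2) \<bullet> (x2 * y1) + (1 / 2) * ((x1 * x2 - x2 * x1) \<bullet> (y2 * qcnj y1 - y1 * qcnj y2))"
    "(y1 * z1) \<bullet> (y2 * z2)
      = (y2 * z1) \<bullet> (y1 * z2) + (1 / 2) * ((z1 * z2 - z2 * z1) \<bullet> (qcnj y2 * y1 - qcnj y1 * y2))"
    "(x1 * y1) \<bullet> (y2 * z2) + (y1 * z1) \<bullet> (x2 * y2)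
      = (x1 * y2) \<bullet> (y1 * z2) + (x2 * y1) \<bullet> (y2 * z1)"
  using assms by (simp_all add: inner_quat_def field_simps)

lemma norm_Im_product_quat:
  fixes y1 y2 :: quat
  shows "(qcnj y2 * y1 - qcnj y1 * y2) \<bullet> (qcnj y2 * y1 - qcnj y1 * y2)
    = (y2 * qcnj y1 - y1 * qcnj y2) \<bullet> (y2 * qcnj y1 - y1 * qcnj y2)"
  by (simp add: inner_quat_def algebra_simps)

text \<open>After the exchange identities the terms with \<open>\<alpha>\<close> and \<open>\<beta>\<close> form a complete square, and the other terms
that belong to the first diagonal entry are
\<open>r1 |X|\<^sup>2 / 8 + (3 r1 / 4 - r1\<^sup>2 / 2) X \<bullet> P + (1 / 2 - 3 r1 / 8) |P|\<^sup>2\<close>. Completing the square in \<open>X\<close> forces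
the coefficient \<open>3 - 2 r1\<close> and leaves \<open>(1 - r1)^3 / 2\<close> in front of \<open>|P|\<^sup>2\<close>. The second diagonal entry behaves in
the same way, and the two remainders can be added because \<open>R\<close> and \<open>P\<close> have the same norm.\<close>

theorem curvature_sum_of_squares:
  fixes x1 y1 z1 x2 y2 z2 :: quat and r1 r2 :: real
  assumes "qRe x1 = 0" "qRe z1 = 0" "qRe x2 = 0" "qRe z2 = 0"
  defines "A \<equiv> sp2_mat x1 y1 z1" and "B \<equiv> sp2_mat x2 y2 z2"
  defines "X \<equiv> x1 * x2 - x2 * x1" and "P \<equiv> y2 * qcnj y1 - y1 * qcnj y2"
    and "Z \<equiv> z1 * z2 - z2 * z1" and "R \<equiv> qcnj y2 * y1 - qcnj y1 * y2"
    and "\<alpha> \<equiv> x1 * y2 - x2 * y1" and "\<beta> \<equiv> y2 * z1 - y1 * z2"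
  shows "inner_r r1 r2 (curv r1 r2 A B B) A
    = (norm (r1 *\<^sub>R \<alpha> - r2 *\<^sub>R \<beta>))\<^sup>2 / 4
      + r1 / 8 * (norm (X + (3 - 2 * r1) *\<^sub>R P))\<^sup>2 + r2 / 8 * (norm (Z + (3 - 2 * r2) *\<^sub>R R))\<^sup>2
      + ((1 - r1) ^ 3 + (1 - r2) ^ 3) / 2 * (norm P)\<^sup>2"
proof -
  define a b c d where abcd: "a = x1 * y2" "b = x2 * y1" "c = y2 * z1" "d = y1 * z2"
  have AB: "A \<in> sp2_alg" "B \<in> sp2_alg"
    using assms by (simp_all add: sp2_mat_in_alg)
  have Re: "qRe (X + P) = 0" "qRe (Z + R) = 0"
    by (simp_all add: X_def P_def Z_def R_def algebra_simps)
  note ex = inner_exchange_quat[OF assms(1,3,2,4), of y1 y2, folded X_def P_def Z_def R_def abcd]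
  have 1: "inner_r r1 r2 (LC_product r1 r2 B B) (LC_product r1 r2 A A)
    = (1 - r1)\<^sup>2 * (a \<bullet> b + (X \<bullet> P) / 2) + (1 - r2)\<^sup>2 * (c \<bullet> d + (Z \<bullet> R) / 2)
      - (1 - r1) * (1 - r2) * (a \<bullet> d + b \<bullet> c)"
  proof -
    have BB: "LC_product r1 r2 B B = sp2_mat 0 ((1 - r1) *\<^sub>R (x2 * y2) - (1 - r2) *\<^sub>R (y2 * z2)) 0"
      by (simp add: LC_product_def B_def qmat_eq_iff) (simp add: quat_eq_iff algebra_simps)
    have AA: "LC_product r1 r2 A A = sp2_mat 0 ((1 - r1) *\<^sub>R (x1 * y1) - (1 - r2) *\<^sub>R (y1 * z1)) 0"
      by (simp add: LC_product_def A_def qmat_eq_iff) (simp add: quat_eq_iff algebra_simps)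
    have "inner_r r1 r2 (LC_product r1 r2 B B) (LC_product r1 r2 A A)
      = (1 - r1)\<^sup>2 * ((x1 * y1) \<bullet> (x2 * y2)) + (1 - r2)\<^sup>2 * ((y1 * z1) \<bullet> (y2 * z2))
        - (1 - r1) * (1 - r2) * ((x1 * y1) \<bullet> (y2 * z2) + (y1 * z1) \<bullet> (x2 * y2))"
      unfolding AA BB
      by (simp add: inner_r_def inner_diff_left inner_diff_right inner_commute[of "x2 * y2"]
          inner_commute[of "y2 * z2"]) (simp add: power2_eq_square algebra_simps)
    then show ?thesis unfolding ex by simp
  qed
  have 2: "inner_r r1 r2 (LC_product r1 r2 A B) (LC_product r1 r2 B A)
    = - (r1 / 8 * ((X + P) \<bullet> (X + P))) - r2 / 8 * ((Z + R) \<bullet> (Z + R))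
      + ((2 - r1) *\<^sub>R a - r1 *\<^sub>R b - (2 - r2) *\<^sub>R c + r2 *\<^sub>R d)
        \<bullet> ((2 - r1) *\<^sub>R b - r1 *\<^sub>R a - (2 - r2) *\<^sub>R d + r2 *\<^sub>R c) / 4"
  proof -
    have "LC_product r1 r2 A B
      = (1 / 2) *\<^sub>R sp2_mat (X + P) ((2 - r1) *\<^sub>R a - r1 *\<^sub>R b - (2 - r2) *\<^sub>R c + r2 *\<^sub>R d) (Z + R)"
      by (simp add: LC_product_def A_def B_def X_def P_def Z_def R_def abcd algebra_simps)
    moreover have "LC_product r1 r2 B A
      = (1 / 2) *\<^sub>R sp2_mat (- (X + P)) ((2 - r1) *\<^sub>R b - r1 *\<^sub>R a - (2 - r2) *\<^sub>R d + r2 *\<^sub>R c) (- (Z + R))"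
      by (simp add: LC_product_def A_def B_def X_def P_def Z_def R_def abcd algebra_simps)
    ultimately show ?thesis
      by (simp only: inner_r_def vector_scaleR_component sp2_mat_nth inner_scaleR_left inner_scaleR_right
          inner_minus_right)
  qed
  have 3: "inner_r r1 r2 (LC_product r1 r2 (A ** B - B ** A) B) A
    = - (r1 / 4 * ((X + P) \<bullet> X)) - r1 / 2 * ((\<alpha> - \<beta>) \<bullet> a)
      - r2 / 4 * ((Z + R) \<bullet> Z) + r2 / 2 * ((\<alpha> - \<beta>) \<bullet> c)
      - (2 - r1) / 4 * ((X + P) \<bullet> P) + r1 / 2 * ((\<alpha> - \<beta>) \<bullet> b)
      - (2 - r2) / 4 * ((Z + R) \<bullet> R) - r2 / 2 * ((\<alpha> - \<beta>) \<bullet> d)"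
  proof -
    have "A ** B - B ** A = sp2_mat (X + P) (\<alpha> - \<beta>) (Z + R)"
      unfolding A_def B_def sp2_mat_bracket[OF assms(1-4)]
      by (simp add: X_def P_def Z_def R_def \<alpha>_def \<beta>_def algebra_simps)
    then have "LC_product r1 r2 (A ** B - B ** A) B = (1 / 2) *\<^sub>R sp2_mat
        (((X + P) * x2 - x2 * (X + P)) + (y2 * qcnj (\<alpha> - \<beta>) - (\<alpha> - \<beta>) * qcnj y2))
        ((2 - r1) *\<^sub>R ((X + P) * y2) - r1 *\<^sub>R (x2 * (\<alpha> - \<beta>))
          - (2 - r2) *\<^sub>R (y2 * (Z + R)) + r2 *\<^sub>R ((\<alpha> - \<beta>) * z2))
        (((Z + R) * z2 - z2 * (Z + R)) + (qcnj y2 * (\<alpha> - \<beta>) - qcnj (\<alpha> - \<beta>) * y2))"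
      by (simp only: LC_product_def Let_def B_def sp2_mat_nth diff_add_eq add_diff_eq)
    then show ?thesis
      by (simp only: A_def inner_r_def vector_scaleR_component sp2_mat_nth inner_scaleR_left
          inner_add_left inner_diff_left[of "_ *\<^sub>R _"] inner_diff_left[of "_ - _ *\<^sub>R _"]
          inner_commutator_quat[OF assms(1,3)] inner_commutator_quat[OF assms(2,4)]
          inner_imaginary_part_quat(1)[OF assms(1)] inner_imaginary_part_quat(2)[OF assms(2)]
          inner_imaginary_mult_quat[OF Re(1)] inner_imaginary_mult_quat[OF Re(2)]
          inner_imaginary_left_quat(1)[OF assms(3)] inner_imaginary_left_quat(2)[OF assms(4)]
          X_def[symmetric] P_def[symmetric] Z_def[symmetric] R_def[symmetric] abcd[symmetric])
         (simp add: field_simps)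
  qed
  have RR: "R \<bullet> R = P \<bullet> P"
    unfolding R_def P_def by (rule norm_Im_product_quat)
  have "\<alpha> = a - b" "\<beta> = c - d" by (simp_all add: \<alpha>_def \<beta>_def abcd)
  then show ?thesis
    unfolding inner_curv[OF AB] 1 2 3 power2_norm_eq_inner
    by (simp add: inner_add_left inner_add_right inner_diff_left inner_diff_right RR
        inner_commute[of b a] inner_commute[of c a] inner_commute[of d a] inner_commute[of c b]
        inner_commute[of d b] inner_commute[of d c] inner_commute[of P X] inner_commute[of R Z])
       (simp add: power2_eq_square power3_eq_cube field_simps)
qed

text \<open>\<open>inner_r\<close> is the pull-back of a Euclidean inner product along \<open>\<phi>\<close>.\<close>

lemma inner_r_Cauchy_Schwarz:
  assumes "r1 > 0" "r2 > 0"
  shows "(inner_r r1 r2 A B)\<^sup>2 \<le> inner_r r1 r2 A A * inner_r r1 r2 B B"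
proof -
  define \<phi> where "\<phi> A = (sqrt (r1 / 2) *\<^sub>R A $ 1 $ 1, A $ 1 $ 2, sqrt (r2 / 2) *\<^sub>R A $ 2 $ 2)" for A :: qmat
  have "inner_r r1 r2 A B = \<phi> A \<bullet> \<phi> B" for A B
    using assms by (simp add: inner_r_def \<phi>_def flip: mult.assoc)
  then show ?thesis by (simp add: Cauchy_Schwarz_ineq)
qed

lemma sectional_curvature_eq:
  assumes "r1 > 0" "r2 > 0" "Q \<in> Sp2" "A \<in> sp2_alg" "B \<in> sp2_alg"
  shows "sectional_curvature (g_r r1 r2) Q (Q ** A) (Q ** B) = inner_r r1 r2 (curv r1 r2 A B B) A
    / (inner_r r1 r2 A A * inner_r r1 r2 B B - (inner_r r1 r2 A B)\<^sup>2)"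
  unfolding sectional_curvature_def riemann_inner[OF assms(1-5,5)]
  by (simp only: g_r_eq Sp2_cancel_left[OF assms(3)])

lemma cube_sum_nonneg_iff:
  fixes a b :: real
  shows "a ^ 3 + b ^ 3 \<ge> 0 \<longleftrightarrow> a + b \<ge> 0"
proof -
  have factor: "a ^ 3 + b ^ 3 = (a + b) * ((a\<^sup>2 + b\<^sup>2 + (a - b)\<^sup>2) / 2)"
    by (simp add: power2_eq_square power3_eq_cube field_simps)
  show ?thesis
  proof (cases "a = 0 \<and> b = 0")
    case False
    then have "a\<^sup>2 + b\<^sup>2 > 0" by (simp add: sum_power2_gt_zero_iff)
    then have "a\<^sup>2 + b\<^sup>2 + (a - b)\<^sup>2 > 0" by (simp add: add_pos_nonneg)
    then show ?thesis unfolding factor by (simp add: zero_le_mult_iff)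
  qed auto
qed

lemma exists_reals_with_sum_prod:
  fixes s p :: real
  assumes "4 * p \<le> s\<^sup>2"
  obtains a b where "a + b = s" "a * b = p"
proof
  let ?d = "sqrt (s\<^sup>2 - 4 * p)"
  have d: "?d * ?d = s\<^sup>2 - 4 * p" using assms by simp
  show "(s + ?d) / 2 + (s - ?d) / 2 = s" by (simp add: field_simps)
  have "(s + ?d) / 2 * ((s - ?d) / 2) = (s\<^sup>2 - ?d * ?d) / 4"
    by (simp add: power2_eq_square algebra_simps)
  then show "(s + ?d) / 2 * ((s - ?d) / 2) = p" unfolding d by simp
qed

text \<open>Take \<open>y1 = 1\<close>, \<open>y2 = i\<close>, so that \<open>P = 2 i\<close> and \<open>R = - 2 i\<close>, and \<open>x1 = p j\<close>, \<open>x2 = q k\<close>, \<open>z1 = p' j\<close>,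
\<open>z2 = q' k\<close>. Then \<open>X = 2 p q i\<close>, \<open>Z = 2 p' q' i\<close>, \<open>\<alpha> = - (p + q) k\<close> and \<open>\<beta> = - (q' - p') k\<close>, and the first
three squares vanish if \<open>p q = 2 r1 - 3\<close>, \<open>p' q' = 3 - 2 r2\<close> and \<open>r1 (p + q) = r2 (q' - p')\<close>. The last
equation holds with \<open>p + q = T r2\<close> and \<open>q' - p' = T r1\<close>; the quadratic equations for the two pairs have
real solutions once \<open>T\<close> is large.\<close>

lemma exists_plane_annihilating_squares:
  assumes "r1 > 0" "r2 > 0" 
  obtains p q p' q' :: real where
    "inner_r r1 r2 (curv r1 r2 (sp2_mat (Quat 0 0 p 0) 1 (Quat 0 0 p' 0))
        (sp2_mat (Quat 0 0 0 q) (Quat 0 1 0 0) (Quat 0 0 0 q'))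
        (sp2_mat (Quat 0 0 0 q) (Quat 0 1 0 0) (Quat 0 0 0 q'))) (sp2_mat (Quat 0 0 p 0) 1 (Quat 0 0 p' 0))
     = 2 * ((1 - r1) ^ 3 + (1 - r2) ^ 3)"
proof -
  \<comment> \<open>this \<open>T\<close> makes both discriminants nonnegative\<close>
  define T where "T = sqrt (8 * r1 / r2\<^sup>2 + 8 * r2 / r1\<^sup>2)"
  have T2: "T\<^sup>2 = 8 * r1 / r2\<^sup>2 + 8 * r2 / r1\<^sup>2"
    using assms by (simp add: T_def)
  have "(T * r2)\<^sup>2 = 8 * r1 + 8 * r2 ^ 3 / r1\<^sup>2" "(T * r1)\<^sup>2 = 8 * r1 ^ 3 / r2\<^sup>2 + 8 * r2"
    unfolding power_mult_distrib T2 using assms by (simp_all add: field_simps power2_eq_square power3_eq_cube)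
  then have T: "(T * r2)\<^sup>2 \<ge> 8 * r1" "(T * r1)\<^sup>2 \<ge> 8 * r2"
    using assms by simp_all
  obtain p q where pq: "p + q = T * r2" "p * q = 2 * r1 - 3"
    using exists_reals_with_sum_prod[of "2 * r1 - 3" "T * r2"] T(1) by auto
  obtain q' m where qm: "q' + m = T * r1" "q' * m = 2 * r2 - 3"
    using exists_reals_with_sum_prod[of "2 * r2 - 3" "T * r1"] T(2) by auto
  define p' where "p' = - m"
  have pq': "q' - p' = T * r1" "p' * q' = 3 - 2 * r2"
    using qm by (simp_all add: p'_def mult.commute)
  let ?x1 = "Quat 0 0 p 0" and ?z1 = "Quat 0 0 p' 0" and ?x2 = "Quat 0 0 0 q" and ?z2 = "Quat 0 0 0 q'"
    and ?i = "Quat 0 1 0 0"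
  have X: "?x1 * ?x2 - ?x2 * ?x1 = Quat 0 (2 * (p * q)) 0 0" by (simp add: quat_eq_iff)
  have P: "?i * qcnj 1 - 1 * qcnj ?i = Quat 0 2 0 0" by (simp add: quat_eq_iff)
  have Z: "?z1 * ?z2 - ?z2 * ?z1 = Quat 0 (2 * (p' * q')) 0 0" by (simp add: quat_eq_iff)
  have R: "qcnj ?i * 1 - qcnj 1 * ?i = Quat 0 (- 2) 0 0" by (simp add: quat_eq_iff)
  have \<alpha>: "?x1 * ?i - ?x2 * 1 = Quat 0 0 0 (- (p + q))" by (simp add: quat_eq_iff)
  have \<beta>: "?i * ?z1 - 1 * ?z2 = Quat 0 0 0 (- (q' - p'))" by (simp add: quat_eq_iff)
  have v1: "r1 *\<^sub>R Quat 0 0 0 (- (p + q)) - r2 *\<^sub>R Quat 0 0 0 (- (q' - p')) = 0"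
    unfolding pq pq' by (simp add: quat_eq_iff)
  have v2: "Quat 0 (2 * (p * q)) 0 0 + (3 - 2 * r1) *\<^sub>R Quat 0 2 0 0 = 0"
    unfolding pq by (simp add: quat_eq_iff algebra_simps)
  have v3: "Quat 0 (2 * (p' * q')) 0 0 + (3 - 2 * r2) *\<^sub>R Quat 0 (- 2) 0 0 = 0"
    unfolding pq' by (simp add: quat_eq_iff algebra_simps)
  have "(norm (Quat 0 2 0 0))\<^sup>2 = 4" by (simp add: quat_norm_sq)
  then have "inner_r r1 r2 (curv r1 r2 (sp2_mat ?x1 1 ?z1) (sp2_mat ?x2 ?i ?z2) (sp2_mat ?x2 ?i ?z2)) (sp2_mat ?x1 1 ?z1)
      = 2 * ((1 - r1) ^ 3 + (1 - r2) ^ 3)"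
    by (subst curvature_sum_of_squares) (simp_all only: X P Z R \<alpha> \<beta> v1 v2 v3, simp_all)
  then show ?thesis by (rule that)
qed

text \<open>The denominator of the sectional curvature is nonnegative by the Cauchy-Schwarz inequality, and positive
on the plane constructed above, whose two generators are orthogonal.\<close>

theorem nonneg_sectional_curvature_iff:
  assumes "r1 > 0" "r2 > 0"
  shows "nonneg_sectional_curvature (g_r r1 r2) \<longleftrightarrow> r1 + r2 \<le> 2"
proof
  assume le: "r1 + r2 \<le> 2"
  show "nonneg_sectional_curvature (g_r r1 r2)"
    unfolding nonneg_sectional_curvature_def
  proof (intro ballI impI)
    fix Q u v assume Q: "Q \<in> Sp2" and u: "u \<in> T_Sp2 Q" and v: "v \<in> T_Sp2 Q"
    obtain A B where A: "u = Q ** A" "A \<in> sp2_alg" and B: "v = Q ** B" "B \<in> sp2_alg"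
      using u v by (auto simp: T_Sp2_eq)
    obtain x1 y1 z1 where A': "A = sp2_mat x1 y1 z1" "qRe x1 = 0" "qRe z1 = 0" using A(2) by (rule sp2_algE)
    obtain x2 y2 z2 where B': "B = sp2_mat x2 y2 z2" "qRe x2 = 0" "qRe z2 = 0" using B(2) by (rule sp2_algE)
    have "(1 - r1) ^ 3 + (1 - r2) ^ 3 \<ge> 0"
      using le by (simp add: cube_sum_nonneg_iff)
    then have "inner_r r1 r2 (curv r1 r2 A B B) A \<ge> 0"
      unfolding A'(1) B'(1) curvature_sum_of_squares[OF A'(2,3) B'(2,3)]
      using assms by (intro add_nonneg_nonneg mult_nonneg_nonneg) auto
    then show "sectional_curvature (g_r r1 r2) Q u v \<ge> 0"
      unfolding A(1) B(1) sectional_curvature_eq[OF assms Q A(2) B(2)]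
      using inner_r_Cauchy_Schwarz[OF assms, of A B] by simp
  qed
next
  assume nonneg: "nonneg_sectional_curvature (g_r r1 r2)"
  obtain p q p' q' where k: "inner_r r1 r2 (curv r1 r2 (sp2_mat (Quat 0 0 p 0) 1 (Quat 0 0 p' 0))
        (sp2_mat (Quat 0 0 0 q) (Quat 0 1 0 0) (Quat 0 0 0 q'))
        (sp2_mat (Quat 0 0 0 q) (Quat 0 1 0 0) (Quat 0 0 0 q'))) (sp2_mat (Quat 0 0 p 0) 1 (Quat 0 0 p' 0))
     = 2 * ((1 - r1) ^ 3 + (1 - r2) ^ 3)"
    using exists_plane_annihilating_squares[OF assms] .
  define A where "A = sp2_mat (Quat 0 0 p 0) 1 (Quat 0 0 p' 0)"
  define B where "B = sp2_mat (Quat 0 0 0 q) (Quat 0 1 0 0) (Quat 0 0 0 q')"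
  have alg: "A \<in> sp2_alg" "B \<in> sp2_alg"
    by (simp_all add: A_def B_def sp2_mat_in_alg)
  have T: "A \<in> T_Sp2 (mat 1)" "B \<in> T_Sp2 (mat 1)"
    using alg by (simp_all add: T_Sp2_eq)
  have "A \<noteq> B" by (simp add: A_def B_def qmat_eq_iff quat_eq_iff)
  moreover have "independent {A, B}"
  proof -
    have "B \<noteq> 0" by (simp add: B_def qmat_eq_iff quat_eq_iff)
    moreover have "A \<notin> span {B}"
      by (auto simp: span_singleton A_def B_def qmat_eq_iff quat_eq_iff)
    ultimately show ?thesis
      by (simp add: independent_insert)
  qed
  ultimately have "sectional_curvature (g_r r1 r2) (mat 1) A B \<ge> 0"
    using nonneg T mat_1_in_Sp2 unfolding nonneg_sectional_curvature_def by blast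
  then have "2 * ((1 - r1) ^ 3 + (1 - r2) ^ 3) / (inner_r r1 r2 A A * inner_r r1 r2 B B - (inner_r r1 r2 A B)\<^sup>2) \<ge> 0"
    using sectional_curvature_eq[OF assms mat_1_in_Sp2 alg] k by (simp add: A_def B_def)
  moreover have "inner_r r1 r2 A A * inner_r r1 r2 B B - (inner_r r1 r2 A B)\<^sup>2 > 0"
  proof -
    have "inner_r r1 r2 A A > 0" "inner_r r1 r2 B B > 0" "inner_r r1 r2 A B = 0"
      using assms by (simp_all add: A_def B_def inner_r_def inner_quat_def add_nonneg_pos add_pos_nonneg)
    then show ?thesis by simp
  qed
  ultimately have "(1 - r1) ^ 3 + (1 - r2) ^ 3 \<ge> 0"
    by (simp add: zero_le_divide_iff)
  then show "r1 + r2 \<le> 2" by (simp add: cube_sum_nonneg_iff)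
qed

section \<open>Ricci curvature\<close>

lemma orthonormal_expansion:
  fixes g :: "'a::real_vector \<Rightarrow> 'a \<Rightarrow> real"
  assumes "bilinear g" "finite B" "\<And>b c. b \<in> B \<Longrightarrow> c \<in> B \<Longrightarrow> g b c = (if b = c then 1 else 0)" "x \<in> span B"
  shows "x = (\<Sum>b\<in>B. g x b *\<^sub>R b)"
proof -
  obtain u where u: "x = (\<Sum>b\<in>B. u b *\<^sub>R b)"
    using assms(4) unfolding span_finite[OF assms(2)] by auto
  have "g x c = u c" if "c \<in> B" for c
  proof -
    have lin: "linear (\<lambda>x. g x c)" using assms(1) by (simp add: bilinear_def)
    have "g x c = (\<Sum>b\<in>B. u b * g b c)"
      unfolding u by (simp add: linear_sum[OF lin] linear_scale[OF lin])
    also have "\<dots> = (\<Sum>b\<in>B. if b = c then u b else 0)"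
      using that assms(3) by (intro sum.cong) auto
    finally show ?thesis using that assms(2) by simp
  qed
  then show ?thesis using u by simp
qed

text \<open>Expanding one argument in the other basis turns both sums into the same double sum.\<close>

lemma orthonormal_trace_unique:
  fixes g \<beta> :: "'a::real_vector \<Rightarrow> 'a \<Rightarrow> real"
  assumes g: "bilinear g" "\<And>x y. g x y = g y x" and \<beta>: "bilinear \<beta>"
    and B: "finite B" "\<And>b c. b \<in> B \<Longrightarrow> c \<in> B \<Longrightarrow> g b c = (if b = c then 1 else 0)"
    and C: "finite C" "\<And>b c. b \<in> C \<Longrightarrow> c \<in> C \<Longrightarrow> g b c = (if b = c then 1 else 0)"
    and "span B = span C"
  shows "(\<Sum>b\<in>B. \<beta> b b) = (\<Sum>c\<in>C. \<beta> c c)"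
proof -
  have lin: "linear (\<lambda>x. \<beta> x y)" "linear (\<lambda>x. \<beta> y x)" for y
    using \<beta> by (auto simp: bilinear_def)
  have "(\<Sum>b\<in>B. \<beta> b b) = (\<Sum>b\<in>B. \<Sum>c\<in>C. g b c * \<beta> c b)"
  proof (intro sum.cong refl)
    fix b assume "b \<in> B"
    then have "b = (\<Sum>c\<in>C. g b c *\<^sub>R c)"
      using orthonormal_expansion[OF g(1) C] assms(8) span_base[of b B] by auto
    then have "\<beta> b b = \<beta> (\<Sum>c\<in>C. g b c *\<^sub>R c) b" by simp
    then show "\<beta> b b = (\<Sum>c\<in>C. g b c * \<beta> c b)"
      by (simp add: linear_sum[OF lin(1)] linear_scale[OF lin(1)])
  qed
  also have "\<dots> = (\<Sum>c\<in>C. \<Sum>b\<in>B. g c b * \<beta> c b)"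
    by (subst sum.swap) (simp add: g(2))
  also have "\<dots> = (\<Sum>c\<in>C. \<beta> c c)"
  proof (intro sum.cong refl)
    fix c assume "c \<in> C"
    then have "c = (\<Sum>b\<in>B. g c b *\<^sub>R b)"
      using orthonormal_expansion[OF g(1) B] assms(8) span_base[of c C] by auto
    then have "\<beta> c c = \<beta> c (\<Sum>b\<in>B. g c b *\<^sub>R b)" by simp
    then show "(\<Sum>b\<in>B. g c b * \<beta> c b) = \<beta> c c"
      by (simp add: linear_sum[OF lin(2)] linear_scale[OF lin(2)])
  qed
  finally show ?thesis .
qed

definition imag_units :: "quat set" where "imag_units = Basis - {1}"

lemma imag_units_eq: "imag_units = {Quat 0 1 0 0, Quat 0 0 1 0, Quat 0 0 0 1}"
  by (auto simp: imag_units_def Basis_quat_def quat_eq_iff)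

lemma imag_units_Re: "u \<in> imag_units \<Longrightarrow> qRe u = 0"
  by (auto simp: imag_units_eq)

lemma inner_unit_mult_quat:
  fixes u v w :: quat
  assumes "u \<in> Basis"
  shows "(u * v) \<bullet> (u * w) = v \<bullet> w" "(v * u) \<bullet> (w * u) = v \<bullet> w"
  using assms by (auto simp: Basis_quat_def inner_quat_def)

text \<open>For the Ricci form the curvature is needed as a bilinear form in its two middle arguments. For a first
argument with a single nonzero entry only few of the products survive.\<close>

lemma curv_diagonal_unit:
  fixes x1 y1 z1 x2 y2 z2 :: quat and r1 r2 :: real
  assumes Re: "qRe x1 = 0" "qRe z1 = 0" "qRe x2 = 0" "qRe z2 = 0" and u: "u \<in> imag_units"
  defines "B \<equiv> sp2_mat x1 y1 z1" and "C \<equiv> sp2_mat x2 y2 z2"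
  shows "inner_r r1 r2 (curv r1 r2 (sp2_mat u 0 0) B C) (sp2_mat u 0 0)
      = r1 / 8 * ((u * x1 - x1 * u) \<bullet> (u * x2 - x2 * u)) + r1\<^sup>2 / 4 * (y1 \<bullet> y2)"
    and "inner_r r1 r2 (curv r1 r2 (sp2_mat 0 0 u) B C) (sp2_mat 0 0 u)
      = r2 / 8 * ((u * z1 - z1 * u) \<bullet> (u * z2 - z2 * u)) + r2\<^sup>2 / 4 * (y1 \<bullet> y2)"
proof -
  have u': "qRe u = 0" "u \<in> Basis" using u by (simp_all add: imag_units_Re imag_units_def)
  have alg: "B \<in> sp2_alg" "C \<in> sp2_alg" "sp2_mat u 0 0 \<in> sp2_alg" "sp2_mat 0 0 u \<in> sp2_alg"
    using Re u' by (simp_all add: B_def C_def sp2_mat_in_alg)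
  let ?W = "u * x1 - x1 * u" and ?W2 = "u * x2 - x2 * u"
  have 1: "LC_product r1 r2 (sp2_mat u 0 0) C = sp2_mat ((1 / 2) *\<^sub>R ?W2) (((2 - r1) / 2) *\<^sub>R (u * y2)) 0"
    "LC_product r1 r2 B (sp2_mat u 0 0) = sp2_mat (- (1 / 2) *\<^sub>R ?W) (- (r1 / 2) *\<^sub>R (u * y1)) 0"
    "LC_product r1 r2 (sp2_mat u 0 0) (sp2_mat u 0 0) = 0"
    "sp2_mat u 0 0 ** B - B ** sp2_mat u 0 0 = sp2_mat ?W (u * y1) 0"
    unfolding B_def C_def sp2_mat_bracket[OF u'(1) zero_quat.simps(1) Re(1,2)]
    by (simp_all add: LC_product_def qmat_eq_iff qcnj_0) (simp_all add: quat_eq_iff field_simps)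
  have 2: "inner_r r1 r2 (LC_product r1 r2 (sp2_mat ?W (u * y1) 0) C) (sp2_mat u 0 0)
      = r1 / 4 * (- (?W \<bullet> ?W2) - 2 * (y1 \<bullet> y2))"
  proof -
    have "inner_r r1 r2 (LC_product r1 r2 (sp2_mat ?W (u * y1) 0) C) (sp2_mat u 0 0)
      = r1 / 4 * (((?W * x2 - x2 * ?W) + (y2 * qcnj (u * y1) - (u * y1) * qcnj y2)) \<bullet> u)"
      by (simp add: LC_product_def Let_def C_def inner_r_def add_diff_eq)
    then show ?thesis
      unfolding inner_add_left inner_commutator_quat[OF u'(1) Re(3)] inner_imaginary_part_quat(1)[OF u'(1)]
        inner_unit_mult_quat(1)[OF u'(2)] by simp
  qed
  show "inner_r r1 r2 (curv r1 r2 (sp2_mat u 0 0) B C) (sp2_mat u 0 0)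
      = r1 / 8 * (?W \<bullet> ?W2) + r1\<^sup>2 / 4 * (y1 \<bullet> y2)"
    unfolding inner_curv[OF alg(3,1)] 1 2
    by (simp only: inner_r_def sp2_mat_nth inner_scaleR_left inner_scaleR_right
        inner_unit_mult_quat[OF u'(2)] inner_commute[of ?W2 ?W] inner_commute[of y2 y1])
       (simp add: power2_eq_square field_simps)
  let ?V = "u * z1 - z1 * u" and ?V2 = "u * z2 - z2 * u"
  have 3: "LC_product r1 r2 (sp2_mat 0 0 u) C = sp2_mat 0 (- ((2 - r2) / 2) *\<^sub>R (y2 * u)) ((1 / 2) *\<^sub>R ?V2)"
    "LC_product r1 r2 B (sp2_mat 0 0 u) = sp2_mat 0 ((r2 / 2) *\<^sub>R (y1 * u)) (- (1 / 2) *\<^sub>R ?V)"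
    "LC_product r1 r2 (sp2_mat 0 0 u) (sp2_mat 0 0 u) = 0"
    "sp2_mat 0 0 u ** B - B ** sp2_mat 0 0 u = sp2_mat 0 (- (y1 * u)) ?V"
    unfolding B_def C_def sp2_mat_bracket[OF zero_quat.simps(1) u'(1) Re(1,2)]
    by (simp_all add: LC_product_def qmat_eq_iff qcnj_0) (simp_all add: quat_eq_iff field_simps)
  have 4: "inner_r r1 r2 (LC_product r1 r2 (sp2_mat 0 (- (y1 * u)) ?V) C) (sp2_mat 0 0 u)
      = r2 / 4 * (- (?V \<bullet> ?V2) - 2 * (y1 \<bullet> y2))"
  proof -
    have "inner_r r1 r2 (LC_product r1 r2 (sp2_mat 0 (- (y1 * u)) ?V) C) (sp2_mat 0 0 u)
      = r2 / 4 * (((?V * z2 - z2 * ?V) + (qcnj y2 * (- (y1 * u)) - qcnj (- (y1 * u)) * y2)) \<bullet> u)"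
      by (simp add: LC_product_def Let_def C_def inner_r_def add_diff_eq)
    then show ?thesis
      unfolding inner_add_left inner_commutator_quat[OF u'(1) Re(4)] inner_imaginary_part_quat(2)[OF u'(1)]
        inner_minus_left inner_unit_mult_quat(2)[OF u'(2)] by simp
  qed
  show "inner_r r1 r2 (curv r1 r2 (sp2_mat 0 0 u) B C) (sp2_mat 0 0 u)
      = r2 / 8 * (?V \<bullet> ?V2) + r2\<^sup>2 / 4 * (y1 \<bullet> y2)"
    unfolding inner_curv[OF alg(4,1)] 3 4
    by (simp only: inner_r_def sp2_mat_nth inner_scaleR_left inner_scaleR_right
        inner_unit_mult_quat[OF u'(2)] inner_commute[of ?V2 ?V] inner_commute[of y2 y1])
       (simp add: power2_eq_square field_simps)
qed

lemma curv_offdiagonal_unit: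
  fixes x1 y1 z1 x2 y2 z2 :: quat and r1 r2 :: real
  assumes Re: "qRe x1 = 0" "qRe z1 = 0" "qRe x2 = 0" "qRe z2 = 0" and u: "u \<in> Basis"
  defines "B \<equiv> sp2_mat x1 y1 z1" and "C \<equiv> sp2_mat x2 y2 z2"
  shows "inner_r r1 r2 (curv r1 r2 (sp2_mat 0 u 0) B C) (sp2_mat 0 u 0) =
      r1\<^sup>2 / 4 * (x1 \<bullet> x2) + r2\<^sup>2 / 4 * (z1 \<bullet> z2) + (4 - 3 / 2 * (r1 + r2)) * (y1 \<bullet> y2 - (u \<bullet> y1) * (u \<bullet> y2))
      - r1 * r2 / 4 * ((x1 * u) \<bullet> (u * z2) + (x2 * u) \<bullet> (u * z1))"
proof -
  define P1 P2 R1 R2 where P: "P1 = y1 * qcnj u - u * qcnj y1" "P2 = y2 * qcnj u - u * qcnj y2"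
    and R: "R1 = qcnj y1 * u - qcnj u * y1" "R2 = qcnj y2 * u - qcnj u * y2"
  define m where "m = u * z1 - x1 * u"
  have alg: "B \<in> sp2_alg" "C \<in> sp2_alg" "sp2_mat 0 u 0 \<in> sp2_alg"
    using Re by (simp_all add: B_def C_def sp2_mat_in_alg)
  have PR: "P1 \<bullet> P2 = 4 * (y1 \<bullet> y2 - (u \<bullet> y1) * (u \<bullet> y2))" "R1 \<bullet> R2 = 4 * (y1 \<bullet> y2 - (u \<bullet> y1) * (u \<bullet> y2))"
    using u by (auto simp: P R Basis_quat_def inner_quat_def algebra_simps)
  have Re': "qRe P1 = 0" "qRe R1 = 0"
    by (simp_all add: P R algebra_simps)
  have 1: "LC_product r1 r2 (sp2_mat 0 u 0) C = (1 / 2) *\<^sub>R sp2_mat P2 (r2 *\<^sub>R (u * z2) - r1 *\<^sub>R (x2 * u)) R2"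
    "LC_product r1 r2 B (sp2_mat 0 u 0) = (1 / 2) *\<^sub>R sp2_mat (- P1) ((2 - r1) *\<^sub>R (x1 * u) - (2 - r2) *\<^sub>R (u * z1)) (- R1)"
    "LC_product r1 r2 (sp2_mat 0 u 0) (sp2_mat 0 u 0) = 0"
    "sp2_mat 0 u 0 ** B - B ** sp2_mat 0 u 0 = sp2_mat P1 m R1"
    unfolding B_def C_def sp2_mat_bracket[OF zero_quat.simps(1) zero_quat.simps(1) Re(1,2)]
    by (simp_all add: LC_product_def P R m_def qmat_eq_iff qcnj_0)
  have 2: "inner_r r1 r2 (LC_product r1 r2 (sp2_mat P1 m R1) C) (sp2_mat 0 u 0)
      = (1 / 2) * (- ((2 - r1) / 2 * (P1 \<bullet> P2)) + r1 * (m \<bullet> (x2 * u)) - (2 - r2) / 2 * (R1 \<bullet> R2) - r2 * (m \<bullet> (u * z2)))"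
  proof -
    have "inner_r r1 r2 (LC_product r1 r2 (sp2_mat P1 m R1) C) (sp2_mat 0 u 0)
      = (1 / 2) * (((2 - r1) *\<^sub>R (P1 * y2) - r1 *\<^sub>R (x2 * m) - (2 - r2) *\<^sub>R (y2 * R1) + r2 *\<^sub>R (m * z2)) \<bullet> u)"
      by (simp add: LC_product_def C_def inner_r_def)
    then show ?thesis
      unfolding inner_add_left inner_diff_left inner_scaleR_left
        inner_imaginary_mult_quat(1)[OF Re'(1), of y2 u] inner_imaginary_mult_quat(2)[OF Re'(2), of y2 u]
        inner_imaginary_left_quat(1)[OF Re(3)] inner_imaginary_left_quat(2)[OF Re(4)]
        P(2)[symmetric] R(2)[symmetric] by simp
  qed
  have 3: "inner_r r1 r2 ((1 / 2) *\<^sub>R sp2_mat P2 (r2 *\<^sub>R (u * z2) - r1 *\<^sub>R (x2 * u)) R2)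
      ((1 / 2) *\<^sub>R sp2_mat (- P1) ((2 - r1) *\<^sub>R (x1 * u) - (2 - r2) *\<^sub>R (u * z1)) (- R1))
    = - (r1 / 8 * (P1 \<bullet> P2)) - r2 / 8 * (R1 \<bullet> R2)
      + (r2 *\<^sub>R (u * z2) - r1 *\<^sub>R (x2 * u)) \<bullet> ((2 - r1) *\<^sub>R (x1 * u) - (2 - r2) *\<^sub>R (u * z1)) / 4"
    by (simp add: inner_r_def inner_commute[of P2] inner_commute[of R2])
  show ?thesis
    unfolding inner_curv[OF alg(3,1)] 1 2 3 PR
    by (simp only: m_def inner_diff_left inner_diff_right inner_scaleR_left inner_scaleR_right
        inner_unit_mult_quat[OF u] inner_commute[of "u * z2" "x1 * u"] inner_commute[of "u * z1" "x2 * u"]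
        inner_commute[of z2 z1] inner_commute[of x2 x1] bounded_bilinear.zero_right[OF bounded_bilinear_inner_r])
       (simp add: power2_eq_square field_simps)
qed

text \<open>The mixed terms of \<open>curv_offdiagonal_unit\<close> disappear in the sum because \<open>u \<mapsto> x u\<close> and \<open>u \<mapsto> u z\<close> are
orthogonal as linear maps for imaginary \<open>x\<close> and \<open>z\<close>.\<close>

lemma sum_curv_units:
  fixes x1 y1 z1 x2 y2 z2 :: quat and r1 r2 :: real
  assumes Re: "qRe x1 = 0" "qRe z1 = 0" "qRe x2 = 0" "qRe z2 = 0"
  defines "B \<equiv> sp2_mat x1 y1 z1" and "C \<equiv> sp2_mat x2 y2 z2"
  shows "(\<Sum>u\<in>imag_units. inner_r r1 r2 (curv r1 r2 (sp2_mat u 0 0) B C) (sp2_mat u 0 0))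
      = r1 * (x1 \<bullet> x2) + 3 * r1\<^sup>2 / 4 * (y1 \<bullet> y2)" (is ?x)
    and "(\<Sum>u\<in>imag_units. inner_r r1 r2 (curv r1 r2 (sp2_mat 0 0 u) B C) (sp2_mat 0 0 u))
      = r2 * (z1 \<bullet> z2) + 3 * r2\<^sup>2 / 4 * (y1 \<bullet> y2)" (is ?z)
    and "(\<Sum>u\<in>Basis. inner_r r1 r2 (curv r1 r2 (sp2_mat 0 u 0) B C) (sp2_mat 0 u 0))
      = r1\<^sup>2 * (x1 \<bullet> x2) + r2\<^sup>2 * (z1 \<bullet> z2) + (12 - 9 / 2 * (r1 + r2)) * (y1 \<bullet> y2)" (is ?y)
proof -
  have card: "card imag_units = 3" "card (Basis :: quat set) = 4"
    by (simp_all add: imag_units_eq Basis_quat_def quat_eq_iff)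
  have comm: "(\<Sum>u\<in>imag_units. (u * x - x * u) \<bullet> (u * y - y * u)) = 8 * (x \<bullet> y)"
    if "qRe x = 0" "qRe y = 0" for x y
    using that by (simp add: imag_units_eq inner_quat_def)
  show ?x ?z
    unfolding B_def C_def
    by (simp_all add: curv_diagonal_unit[OF Re] sum.distrib comm Re card flip: sum_distrib_left sum_divide_distrib)
  have mixed: "(\<Sum>u\<in>Basis. (x * u) \<bullet> (u * z)) = 0" if "qRe x = 0" "qRe z = 0" for x z :: quat
    using that by (simp add: Basis_quat_def inner_quat_def quat_eq_iff)
  have Parseval: "(\<Sum>u\<in>Basis. (u \<bullet> y1) * (u \<bullet> y2)) = y1 \<bullet> y2"
    by (subst euclidean_inner[of y1 y2]) (simp add: inner_commute)
  have "(\<Sum>u\<in>Basis. inner_r r1 r2 (curv r1 r2 (sp2_mat 0 u 0) B C) (sp2_mat 0 u 0))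
    = (\<Sum>u\<in>Basis. r1\<^sup>2 / 4 * (x1 \<bullet> x2) + r2\<^sup>2 / 4 * (z1 \<bullet> z2)
        + (4 - 3 / 2 * (r1 + r2)) * (y1 \<bullet> y2 - (u \<bullet> y1) * (u \<bullet> y2))
        - r1 * r2 / 4 * ((x1 * u) \<bullet> (u * z2) + (x2 * u) \<bullet> (u * z1)))"
    unfolding B_def C_def by (intro sum.cong refl curv_offdiagonal_unit[OF Re])
  also have "\<dots> = r1\<^sup>2 * (x1 \<bullet> x2) + r2\<^sup>2 * (z1 \<bullet> z2)
        + (4 - 3 / 2 * (r1 + r2)) * (4 * (y1 \<bullet> y2) - (\<Sum>u\<in>Basis. (u \<bullet> y1) * (u \<bullet> y2)))
        - r1 * r2 / 4 * ((\<Sum>u\<in>Basis. (x1 * u) \<bullet> (u * z2)) + (\<Sum>u\<in>Basis. (x2 * u) \<bullet> (u * z1)))"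
    by (simp add: sum.distrib sum_subtractf card flip: sum_distrib_left sum_divide_distrib)
  also have "\<dots> = r1\<^sup>2 * (x1 \<bullet> x2) + r2\<^sup>2 * (z1 \<bullet> z2) + (12 - 9 / 2 * (r1 + r2)) * (y1 \<bullet> y2)"
    unfolding mixed[OF Re(1,4)] mixed[OF Re(3,2)] Parseval by (simp add: algebra_simps)
  finally show ?y .
qed

definition sp2_frame :: "real \<Rightarrow> real \<Rightarrow> qmat set" where
  "sp2_frame r1 r2 = (\<lambda>u. sqrt (2 / r1) *\<^sub>R sp2_mat u 0 0) ` imag_units
    \<union> (\<lambda>u. sp2_mat 0 u 0) ` Basis \<union> (\<lambda>u. sqrt (2 / r2) *\<^sub>R sp2_mat 0 0 u) ` imag_units"

lemma finite_sp2_frame: "finite (sp2_frame r1 r2)"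
  by (simp add: sp2_frame_def imag_units_def)

lemma sp2_frame_orthonormal:
  assumes "r1 > 0" "r2 > 0" "b \<in> sp2_frame r1 r2" "c \<in> sp2_frame r1 r2"
  shows "inner_r r1 r2 b c = (if b = c then 1 else 0)"
proof -
  have pos: "r1 / 2 * (sqrt (2 / r1) * (sqrt (2 / r1) * t)) = t" "r2 / 2 * (sqrt (2 / r2) * (sqrt (2 / r2) * t)) = t" for t
    using assms(1,2) by (simp_all flip: mult.assoc)
  have nz: "u \<noteq> 0" if "u \<in> Basis" for u :: quat using that by auto
  show ?thesis
    using assms
    by (auto simp: sp2_frame_def inner_r_def pos inner_Basis imag_units_def qmat_eq_iff qcnj_0 nz)
qed

lemma span_sp2_frame:
  assumes "r1 > 0" "r2 > 0"
  shows "span (sp2_frame r1 r2) = sp2_alg"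
proof
  show "span (sp2_frame r1 r2) \<subseteq> sp2_alg"
    by (rule span_minimal[OF _ subspace_sp2_alg])
       (auto simp: sp2_frame_def imag_units_Re intro!: subspace_scale[OF subspace_sp2_alg] sp2_mat_in_alg)
  show "sp2_alg \<subseteq> span (sp2_frame r1 r2)"
  proof
    fix A assume "A \<in> sp2_alg"
    then obtain x y z where A: "A = sp2_mat x y z" "qRe x = 0" "qRe z = 0" by (rule sp2_algE)
    have unscale: "a *\<^sub>R B \<in> span (sp2_frame r1 r2)" if "s *\<^sub>R B \<in> sp2_frame r1 r2" "s \<noteq> 0" for a s and B :: qmat
      using span_scale[OF span_base[OF that(1)], of "a / s"] that(2) by simp
    have "(\<Sum>u\<in>imag_units. (x \<bullet> u) *\<^sub>R sp2_mat u 0 0) \<in> span (sp2_frame r1 r2)"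
      by (intro span_sum unscale[of "sqrt (2 / r1)"]) (use assms in \<open>auto simp: sp2_frame_def\<close>)
    moreover have "(\<Sum>u\<in>imag_units. (z \<bullet> u) *\<^sub>R sp2_mat 0 0 u) \<in> span (sp2_frame r1 r2)"
      by (intro span_sum unscale[of "sqrt (2 / r2)"]) (use assms in \<open>auto simp: sp2_frame_def\<close>)
    moreover have "(\<Sum>u\<in>Basis. (y \<bullet> u) *\<^sub>R sp2_mat 0 u 0) \<in> span (sp2_frame r1 r2)"
      by (intro span_sum unscale[of 1]) (auto simp: sp2_frame_def)
    moreover have "A = (\<Sum>u\<in>imag_units. (x \<bullet> u) *\<^sub>R sp2_mat u 0 0)
        + (\<Sum>u\<in>Basis. (y \<bullet> u) *\<^sub>R sp2_mat 0 u 0) + (\<Sum>u\<in>imag_units. (z \<bullet> u) *\<^sub>R sp2_mat 0 0 u)"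
      using A by (simp add: imag_units_eq Basis_quat_def qmat_eq_iff quat_eq_iff inner_quat_def)
    ultimately show "A \<in> span (sp2_frame r1 r2)"
      by (simp add: span_add)
  qed
qed

lemma sum_sp2_frame:
  assumes "r1 > 0" "r2 > 0"
  shows "sum f (sp2_frame r1 r2) = (\<Sum>u\<in>imag_units. f (sqrt (2 / r1) *\<^sub>R sp2_mat u 0 0))
    + (\<Sum>u\<in>Basis. f (sp2_mat 0 u 0)) + (\<Sum>u\<in>imag_units. f (sqrt (2 / r2) *\<^sub>R sp2_mat 0 0 u))"
proof -
  have nz: "u \<noteq> 0" if "u \<in> Basis" for u :: quat using that by auto
  have fin: "finite imag_units" by (simp add: imag_units_def)
  have inj: "inj_on (\<lambda>u. sqrt (2 / r1) *\<^sub>R sp2_mat u 0 0) imag_units" "inj_on (\<lambda>u. sp2_mat 0 u 0) Basis"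
    "inj_on (\<lambda>u. sqrt (2 / r2) *\<^sub>R sp2_mat 0 0 u) imag_units"
    using assms by (auto simp: inj_on_def qmat_eq_iff)
  have disj: "((\<lambda>u. sqrt (2 / r1) *\<^sub>R sp2_mat u 0 0) ` imag_units) \<inter> ((\<lambda>u. sp2_mat 0 u 0) ` Basis) = {}"
    "((\<lambda>u. sqrt (2 / r1) *\<^sub>R sp2_mat u 0 0) ` imag_units \<union> (\<lambda>u. sp2_mat 0 u 0) ` Basis)
      \<inter> ((\<lambda>u. sqrt (2 / r2) *\<^sub>R sp2_mat 0 0 u) ` imag_units) = {}"
    using assms nz by (auto simp: qmat_eq_iff imag_units_def)
  have "sum f (sp2_frame r1 r2) = sum f ((\<lambda>u. sqrt (2 / r1) *\<^sub>R sp2_mat u 0 0) ` imag_units)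
    + sum f ((\<lambda>u. sp2_mat 0 u 0) ` Basis) + sum f ((\<lambda>u. sqrt (2 / r2) *\<^sub>R sp2_mat 0 0 u) ` imag_units)"
    unfolding sp2_frame_def by (simp add: sum.union_disjoint disj fin)
  then show ?thesis
    by (simp add: sum.reindex inj)
qed

lemma orthonormal_basis_sp2_frame:
  assumes "r1 > 0" "r2 > 0" "Q \<in> Sp2"
  shows "orthonormal_basis (g_r r1 r2) Q ((\<lambda>A. Q ** A) ` sp2_frame r1 r2)"
  unfolding orthonormal_basis_def
proof (intro conjI ballI)
  show "finite ((\<lambda>A. Q ** A) ` sp2_frame r1 r2)" by (simp add: finite_sp2_frame)
  have "linear (\<lambda>A :: qmat. Q ** A)" by (rule linearI) (simp_all add: qmat_mult_simps)
  then show "span ((\<lambda>A. Q ** A) ` sp2_frame r1 r2) = T_Sp2 Q"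
    by (simp add: linear_span_image span_sp2_frame[OF assms(1,2)] T_Sp2_eq)
  fix b c assume "b \<in> (\<lambda>A. Q ** A) ` sp2_frame r1 r2" "c \<in> (\<lambda>A. Q ** A) ` sp2_frame r1 r2"
  then obtain B C where "b = Q ** B" "c = Q ** C" "B \<in> sp2_frame r1 r2" "C \<in> sp2_frame r1 r2" by auto
  moreover from this have "b = c \<longleftrightarrow> B = C"
    using Sp2_cancel_left[OF assms(3)] by metis
  ultimately show "g_r r1 r2 Q b c = (if b = c then 1 else 0)"
    by (simp add: g_r_eq Sp2_cancel_left[OF assms(3)] sp2_frame_orthonormal[OF assms(1,2)])
qed

lemma bilinear_curv:
  fixes P :: qmat
  shows "bilinear (\<lambda>U V. inner_r r1 r2 (curv r1 r2 (P ** U) B C) (P ** V))"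
  unfolding bilinear_def
  by (auto intro!: linearI simp: curv_def LC_product_simps inner_r_simps qmat_mult_simps algebra_simps
      bounded_bilinear.scaleR_left[OF bounded_bilinear_inner_r]
      bounded_bilinear.scaleR_right[OF bounded_bilinear_inner_r])

text \<open>The trace may be taken in the frame, where the scaling of the diagonal units contributes the factors
\<open>2 / r1\<close> and \<open>2 / r2\<close>.\<close>

theorem ricci_eq:
  assumes r: "r1 > 0" "r2 > 0" and Q: "Q \<in> Sp2"
    and Re: "qRe x1 = 0" "qRe z1 = 0" "qRe x2 = 0" "qRe z2 = 0"
  shows "ricci (g_r r1 r2) Q (Q ** sp2_mat x1 y1 z1) (Q ** sp2_mat x2 y2 z2)
    = (r1\<^sup>2 + 2) * (x1 \<bullet> x2) + (12 - 3 * (r1 + r2)) * (y1 \<bullet> y2) + (r2\<^sup>2 + 2) * (z1 \<bullet> z2)"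
proof -
  define B C where "B = sp2_mat x1 y1 z1" and "C = sp2_mat x2 y2 z2"
  have BC: "B \<in> sp2_alg" "C \<in> sp2_alg" using Re by (simp_all add: B_def C_def sp2_mat_in_alg)
  define \<beta> where "\<beta> U V = inner_r r1 r2 (curv r1 r2 (qadj Q ** U) B C) (qadj Q ** V)" for U V
  have \<beta>: "bilinear \<beta>" unfolding \<beta>_def by (rule bilinear_curv)
  let ?E = "(\<lambda>A. Q ** A) ` sp2_frame r1 r2"
  have trace: "(\<Sum>b\<in>S. g_r r1 r2 Q (riemann (g_r r1 r2) Q b (Q ** B) (Q ** C)) b) = (\<Sum>b\<in>?E. \<beta> b b)"
    if S: "orthonormal_basis (g_r r1 r2) Q S" for S
  proof -
    have "(\<Sum>b\<in>S. g_r r1 r2 Q (riemann (g_r r1 r2) Q b (Q ** B) (Q ** C)) b) = (\<Sum>b\<in>S. \<beta> b b)"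
    proof (intro sum.cong refl)
      fix b assume "b \<in> S"
      then have "b \<in> T_Sp2 Q" using S span_base by (auto simp: orthonormal_basis_def)
      then have b: "qadj Q ** b \<in> sp2_alg" "Q ** (qadj Q ** b) = b"
        using Q by (simp_all add: mem_T_Sp2_iff Sp2_cancel_right)
      show "g_r r1 r2 Q (riemann (g_r r1 r2) Q b (Q ** B) (Q ** C)) b = \<beta> b b"
        using riemann_inner[OF r Q b(1) BC, of "qadj Q ** b"] by (simp add: b(2) \<beta>_def)
    qed
    also have "\<dots> = (\<Sum>b\<in>?E. \<beta> b b)"
      using S orthonormal_basis_sp2_frame[OF r Q]
      by (intro orthonormal_trace_unique[OF g_r_bilinear g_r_commute \<beta>, of S r1 r2 Q ?E]) (auto simp: orthonormal_basis_def)
    finally show ?thesis .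
  qed
  have "ricci (g_r r1 r2) Q (Q ** B) (Q ** C) = (\<Sum>b\<in>?E. \<beta> b b)"
    unfolding ricci_def
  proof (rule the_equality)
    show "\<exists>S. orthonormal_basis (g_r r1 r2) Q S \<and>
        (\<Sum>b\<in>?E. \<beta> b b) = (\<Sum>b\<in>S. g_r r1 r2 Q (riemann (g_r r1 r2) Q b (Q ** B) (Q ** C)) b)"
      using orthonormal_basis_sp2_frame[OF r Q] trace[OF orthonormal_basis_sp2_frame[OF r Q]]
      by (intro exI[of _ ?E]) simp
  qed (auto simp: trace)
  also have "\<dots> = (\<Sum>A\<in>sp2_frame r1 r2. inner_r r1 r2 (curv r1 r2 A B C) A)"
  proof -
    have "inj_on (\<lambda>A. Q ** A) (sp2_frame r1 r2)"
      by (rule inj_on_inverseI[where g = "\<lambda>A. qadj Q ** A"]) (rule Sp2_cancel_left[OF Q])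
    then show ?thesis
      by (simp add: sum.reindex \<beta>_def Sp2_cancel_left[OF Q])
  qed
  also have "\<dots> = 2 / r1 * (r1 * (x1 \<bullet> x2) + 3 * r1\<^sup>2 / 4 * (y1 \<bullet> y2))
      + (r1\<^sup>2 * (x1 \<bullet> x2) + r2\<^sup>2 * (z1 \<bullet> z2) + (12 - 9 / 2 * (r1 + r2)) * (y1 \<bullet> y2))
      + 2 / r2 * (r2 * (z1 \<bullet> z2) + 3 * r2\<^sup>2 / 4 * (y1 \<bullet> y2))"
  proof -
    have scale: "inner_r r1 r2 (curv r1 r2 (s *\<^sub>R A) B C) (s *\<^sub>R A) = s\<^sup>2 * inner_r r1 r2 (curv r1 r2 A B C) A" for s A
      using bilinear_lmul[OF bilinear_curv[where P = "mat 1" and B = B and C = C and ?r1.0 = r1 and ?r2.0 = r2], of s A "s *\<^sub>R A"]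
        bilinear_rmul[OF bilinear_curv[where P = "mat 1" and B = B and C = C and ?r1.0 = r1 and ?r2.0 = r2], of A s A]
      by (simp add: power2_eq_square)
    show ?thesis
      unfolding sum_sp2_frame[OF r] scale sum_distrib_left[symmetric]
        sum_curv_units[OF Re, where ?y1.0 = y1 and ?y2.0 = y2, folded B_def C_def]
      using r by simp
  qed
  also have "\<dots> = (r1\<^sup>2 + 2) * (x1 \<bullet> x2) + (12 - 3 * (r1 + r2)) * (y1 \<bullet> y2) + (r2\<^sup>2 + 2) * (z1 \<bullet> z2)"
    using r by (simp add: field_simps power2_eq_square)
  finally show ?thesis by (simp add: B_def C_def)
qed

text \<open>Comparing the three coefficients gives \<open>2 r1\<^sup>2 + 4 = c r1\<close>, \<open>2 r2\<^sup>2 + 4 = c r2\<close> and \<open>c = 12 - 3 (r1 + r2)\<close>.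
The first two show \<open>r1 = r2\<close> or \<open>c = 2 (r1 + r2)\<close>. In the first case \<open>(r1 - 1) (2 r1 - 1) = 0\<close>; in the
second one \<open>c = 24 / 5\<close>, for which the quadratic equation has no real solution.\<close>

theorem einstein_iff:
  assumes r: "r1 > 0" "r2 > 0"
  shows "einstein (g_r r1 r2) \<longleftrightarrow> (r1 = 1 \<and> r2 = 1) \<or> (r1 = 1 / 2 \<and> r2 = 1 / 2)"
proof
  assume "einstein (g_r r1 r2)"
  then obtain c where c: "\<And>Q v w. Q \<in> Sp2 \<Longrightarrow> v \<in> T_Sp2 Q \<Longrightarrow> w \<in> T_Sp2 Q \<Longrightarrow>
      ricci (g_r r1 r2) Q v w = c * g_r r1 r2 Q v w"
    unfolding einstein_def by blast
  have diag: "(r1\<^sup>2 + 2) * (x \<bullet> x) + (12 - 3 * (r1 + r2)) * (y \<bullet> y) + (r2\<^sup>2 + 2) * (z \<bullet> z)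
      = c * (r1 / 2 * (x \<bullet> x) + y \<bullet> y + r2 / 2 * (z \<bullet> z))" if "qRe x = 0" "qRe z = 0" for x y z :: quat
    using c[OF mat_1_in_Sp2, of "mat 1 ** sp2_mat x y z" "mat 1 ** sp2_mat x y z"]
      sp2_mat_in_alg[OF that, of y] ricci_eq[OF r mat_1_in_Sp2 that that, of y y]
    by (simp add: T_Sp2_eq g_r_eq qadj_mat_1 inner_r_def)
  let ?i = "Quat 0 1 0 0"
  have i: "?i \<bullet> ?i = 1" "(1 :: quat) \<bullet> 1 = 1" by (simp_all add: inner_quat_def)
  have 1: "2 * r1\<^sup>2 + 4 = c * r1" using diag[of ?i 0 0] by (simp add: i)
  have 2: "c = 12 - 3 * (r1 + r2)" using diag[of 0 0 1] by (simp add: i)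
  have 3: "2 * r2\<^sup>2 + 4 = c * r2" using diag[of 0 ?i 0] by (simp add: i)
  have "(r1 - r2) * (2 * (r1 + r2) - c) = 0"
    using 1 3 by (simp add: power2_eq_square algebra_simps)
  then consider "r1 = r2" | "c = 2 * (r1 + r2)" by auto
  then show "(r1 = 1 \<and> r2 = 1) \<or> (r1 = 1 / 2 \<and> r2 = 1 / 2)"
  proof cases
    case 1
    then have "(r1 - 1) * (2 * r1 - 1) = 0"
      using \<open>2 * r1\<^sup>2 + 4 = c * r1\<close> 2 by (simp add: power2_eq_square algebra_simps)
    then show ?thesis using 1 by auto
  next
    case 2
    then have "c = 24 / 5" using \<open>c = 12 - 3 * (r1 + r2)\<close> by simp
    then have "(r1 - 6 / 5)\<^sup>2 < 0"
      using 1 unfolding \<open>c = 24 / 5\<close> by (simp add: power2_eq_square field_simps)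
    then show ?thesis by simp
  qed
next
  assume "(r1 = 1 \<and> r2 = 1) \<or> (r1 = 1 / 2 \<and> r2 = 1 / 2)"
  then have coeff: "r1\<^sup>2 + 2 = (12 - 3 * (r1 + r2)) * (r1 / 2)" "r2\<^sup>2 + 2 = (12 - 3 * (r1 + r2)) * (r2 / 2)"
    by (elim disjE conjE; simp only:; simp add: power2_eq_square)+
  have "ricci (g_r r1 r2) Q v w = (12 - 3 * (r1 + r2)) * g_r r1 r2 Q v w"
    if Q: "Q \<in> Sp2" and "v \<in> T_Sp2 Q" "w \<in> T_Sp2 Q" for Q v w
  proof -
    obtain x1 y1 z1 where v: "v = Q ** sp2_mat x1 y1 z1" "qRe x1 = 0" "qRe z1 = 0"
      using \<open>v \<in> T_Sp2 Q\<close> by (auto simp: T_Sp2_def)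
    obtain x2 y2 z2 where w: "w = Q ** sp2_mat x2 y2 z2" "qRe x2 = 0" "qRe z2 = 0"
      using \<open>w \<in> T_Sp2 Q\<close> by (auto simp: T_Sp2_def)
    show ?thesis
      unfolding v(1) w(1) ricci_eq[OF r Q v(2,3) w(2,3)] g_r_eq Sp2_cancel_left[OF Q] coeff
      by (simp add: inner_r_def distrib_left)
  qed
  then show "einstein (g_r r1 r2)"
    unfolding einstein_def by blast
qed


section \<open>Nonnegative curvature and the Einstein condition\<close>

theorem theorem1p1:
  fixes r1 r2 :: real
  assumes "r1 > 0" and "r2 > 0"
  shows "(nonneg_sectional_curvature (g_r r1 r2) \<longleftrightarrow> r1 + r2 \<le> 2) \<and>
         (einstein (g_r r1 r2) \<longleftrightarrow> (r1 = 1 \<and> r2 = 1) \<or> (r1 = 1 / 2 \<and> r2 = 1 / 2))"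
  using nonneg_sectional_curvature_iff[OF assms] einstein_iff[OF assms] by blast

end
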